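(* (Heisenberg's uncertainty inequality for the MFrFT) For every $f\in L^2(\mathbb{R}^N)$, $$\left(\int_{\mathbb{R}^N}\|\boldsymbol t\|^2|f(\boldsymbol t)|^2\,d\boldsymbol t\right)\left(\int_{\mathbb{R}^N}\|\boldsymbol\xi\|^2|(\mathfrak F_{\boldsymbol\alpha,\lambda}f)(\boldsymbol\xi)|^2\,d\boldsymbol\xi\right)\ \ge\ P_{\boldsymbol\alpha,\lambda}\,\frac{N^2}{4}\,\|f\|^4_{L^2(\mathbb{R}^N)},$$ where $$P_{\boldsymbol\alpha,\lambda}=\frac{|c(\boldsymbol\alpha_\lambda)|^2\,|\sin\boldsymbol\alpha|_m}{M^2(\lambda^2)^{N+2}},\qquad M^2=\max_{1\le i\le N}\frac1{\sin^2\alpha_i}.$$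
   Context: $N\ge1$ is an integer, $\lambda\in\mathbb{R}\setminus\{0\}$, $\boldsymbol\alpha=(\alpha_1,\dots,\alpha_N)$ with $\alpha_k\in(-\pi,\pi)\setminus\{0\}$. $\|\cdot\|$ is the Euclidean norm on $\mathbb{R}^N$; $|\sin\boldsymbol\alpha|_m=|\sin\alpha_1\sin\alpha_2\cdots\sin\alpha_N|$. Put $a(\alpha_k)=\tfrac12\cot\alpha_k$, $c(\alpha_k)=\sqrt{1-i\cot\alpha_k}$, $c(\boldsymbol\alpha_\lambda)=c(\alpha_1)\cdots c(\alpha_N)$, $e_{\boldsymbol\alpha,\lambda^2}(\boldsymbol x)=e^{i\lambda^2\sum_{k=1}^N a(\alpha_k)x_k^2}$. The multidimensional fractional Fourier transform (MFrFT) is $(\mathfrak F_{\boldsymbol\alpha,\lambda}f)(\boldsymbol\xi)=\int_{\mathbb{R}^N}f(\boldsymbol x)K_{\boldsymbol\alpha,\lambda}(\boldsymbol x,\boldsymbol\xi)\,d\boldsymbol x$ (extended to $L^2(\mathbb{R}^N)$ as usual), with kernel $K_{\boldsymbol\alpha,\lambda}(\boldsymbol x,\boldsymbol\xi)=\frac{c(\boldsymbol\alpha_\lambda)}{(\sqrt{2\pi})^N}e_{\boldsymbol\alpha,\lambda^2}(\boldsymbol x)e_{\boldsymbol\alpha,\lambda^2}(\boldsymbol\xi)e^{-i\lambda^2\sum_{k=1}^N x_k\xi_k\csc\alpha_k}$. *)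

theory Defs
  imports "HOL-Analysis.Analysis"
begin

text \<open>
  \<open>\<real>\<^sup>N\<close> is \<^typ>\<open>real ^ 'n\<close> with \<open>N = CARD('n)\<close>. Elements of \<open>L\<^sup>2\<close> are represented by functions,
  so statements about them are to be read up to Lebesgue-null sets.
\<close>

definition square_integrable :: "(real ^ 'n \<Rightarrow> complex) \<Rightarrow> bool" where
  "square_integrable f \<longleftrightarrow>
     f \<in> borel_measurable lebesgue \<and> integrable lebesgue (\<lambda>x. (cmod (f x))\<^sup>2)"

definition L2norm :: "(real ^ 'n \<Rightarrow> complex) \<Rightarrow> real" where
  "L2norm f = sqrt (LINT x|lebesgue. (cmod (f x))\<^sup>2)"

text \<open>
  Membership in \<open>L\<^sup>2\<close> is part of the notion of convergence, because \<^const>\<open>L2norm\<close> is \<open>0\<close>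
  by convention on functions that are not square integrable.
\<close>

definition L2_tendsto :: "(nat \<Rightarrow> real ^ 'n \<Rightarrow> complex) \<Rightarrow> (real ^ 'n \<Rightarrow> complex) \<Rightarrow> bool" where
  "L2_tendsto u f \<longleftrightarrow>
     (\<forall>n. square_integrable (u n)) \<and> square_integrable f \<and>
     (\<lambda>n. L2norm (\<lambda>x. u n x - f x)) \<longlonglongrightarrow> 0"

definition frft_a :: "real \<Rightarrow> real" where
  "frft_a t = cot t / 2"

definition frft_c :: "real \<Rightarrow> complex" where
  "frft_c t = csqrt (1 - \<i> * complex_of_real (cot t))"

definition mfrft_c :: "real ^ 'n \<Rightarrow> complex" where
  "mfrft_c \<alpha> = (\<Prod>k\<in>UNIV. frft_c (\<alpha> $ k))"

definition mfrft_chirp :: "real ^ 'n \<Rightarrow> real \<Rightarrow> real ^ 'n \<Rightarrow> complex" where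
  "mfrft_chirp \<alpha> lam x =
     exp (\<i> * complex_of_real (lam\<^sup>2 * (\<Sum>k\<in>UNIV. frft_a (\<alpha> $ k) * (x $ k)\<^sup>2)))"

definition mfrft_kernel :: "real ^ 'n \<Rightarrow> real \<Rightarrow> real ^ 'n \<Rightarrow> real ^ 'n \<Rightarrow> complex" where
  "mfrft_kernel \<alpha> lam x \<xi> =
     mfrft_c \<alpha> / complex_of_real (sqrt (2 * pi) ^ CARD('n))
       * mfrft_chirp \<alpha> lam x * mfrft_chirp \<alpha> lam \<xi>
       * exp (- \<i> * complex_of_real (lam\<^sup>2 * (\<Sum>k\<in>UNIV. x $ k * \<xi> $ k * (1 / sin (\<alpha> $ k)))))"

definition mfrft_integral ::
    "real ^ 'n \<Rightarrow> real \<Rightarrow> (real ^ 'n \<Rightarrow> complex) \<Rightarrow> real ^ 'n \<Rightarrow> complex" where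
  "mfrft_integral \<alpha> lam f \<xi> = (LINT x|lebesgue. f x * mfrft_kernel \<alpha> lam x \<xi>)"

text \<open>
  The transform on \<open>L\<^sup>2\<close> is the continuous extension of the integral transform from the dense
  subspace \<open>L\<^sup>1 \<inter> L\<^sup>2\<close>. The choice operator only selects a representative: every
  square integrable \<open>f\<close> is the \<open>L\<^sup>2\<close>-limit of some such sequence \<open>u\<close> (truncate \<open>f\<close> to balls),
  so two functions with the stated property agree almost everywhere.
\<close>

definition mfrft :: "real ^ 'n \<Rightarrow> real \<Rightarrow> (real ^ 'n \<Rightarrow> complex) \<Rightarrow> real ^ 'n \<Rightarrow> complex" where
  "mfrft \<alpha> lam f =
     (SOME g. square_integrable g \<and>
        (\<forall>u. (\<forall>n. integrable lebesgue (u n)) \<longrightarrow> L2_tendsto u f \<longrightarrow>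
              L2_tendsto (\<lambda>n. mfrft_integral \<alpha> lam (u n)) g))"

definition abs_sin_prod :: "real ^ 'n \<Rightarrow> real" where
  "abs_sin_prod \<alpha> = \<bar>\<Prod>k\<in>UNIV. sin (\<alpha> $ k)\<bar>"

definition heisenberg_M2 :: "real ^ 'n \<Rightarrow> real" where
  "heisenberg_M2 \<alpha> = Max (range (\<lambda>i. 1 / (sin (\<alpha> $ i))\<^sup>2))"

definition heisenberg_P :: "real ^ 'n \<Rightarrow> real \<Rightarrow> real" where
  "heisenberg_P \<alpha> lam =
     (cmod (mfrft_c \<alpha>))\<^sup>2 * abs_sin_prod \<alpha> / (heisenberg_M2 \<alpha> * (lam\<^sup>2) ^ (CARD('n) + 2))"

end

theory Submission
  imports Defs "HOL-Probability.Characteristic_Functions"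
begin

text \<open>
  Let \<open>N = CARD('n)\<close> and \<open>M\<^sup>2 = heisenberg_M2 \<alpha>\<close>.

  Write \<open>p\<close> for \<open>f\<close> times the chirp. Since chirps have modulus \<open>1\<close>, the modulus of the fractional transform of \<open>f\<close>
  is, up to a constant, that of the Fourier transform of \<open>p\<close> at the point with coordinates
  \<open>lam\<^sup>2 * \<xi> $ k / sin (\<alpha> $ k)\<close> (\<open>mfrft_integral_eq_fourier\<close>). So the inequality is Heisenberg's inequality for the ordinary
  Fourier transform in rescaled frequencies. The modulus of the constant \<open>mfrft_c \<alpha>\<close> is such that
  \<open>|mfrft_c \<alpha>|\<^sup>2 * abs_sin_prod \<alpha> = 1\<close>, which leaves \<open>heisenberg_P \<alpha> lam = 1 / (M\<^sup>2 * (lam\<^sup>2)^(N + 2))\<close>: a factor \<open>(lam\<^sup>2)^N\<close>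
  by which the transform fails to be unitary (\<open>mfrft_integral_isometry\<close>), and the factor
  \<open>(lam\<^sup>2)\<^sup>2 / (sin (\<alpha> $ k))\<^sup>2 \<le> lam^4 * M\<^sup>2\<close> from the rescaling of the frequencies.

  For each coordinate the inequality comes from comparing \<open>p\<close> with its translate by a small step \<open>h\<close> in that
  direction. On the one hand, the norm of the difference is at most \<open>h\<close> times the norm of the corresponding
  frequency times the transform, by Plancherel's theorem (\<open>L2norm_shift_diff_le_mfrft\<close>). On the other hand, moving
  the translation onto the weight \<open>x $ k\<close> and applying the Cauchy-Schwarz inequality shows that the difference
  cannot be small if \<open>x $ k * p\<close> is small (\<open>uncertainty_finite_difference\<close>). Letting \<open>h\<close> tend to \<open>0\<close> gives the inequality for one
  coordinate, without assuming that \<open>p\<close> is differentiable in any sense; a second application of the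
  Cauchy-Schwarz inequality sums over the coordinates (\<open>heisenberg_finite\<close>).

  The analytic input is Plancherel's theorem for functions that are integrable and square integrable
  (\<open>plancherel\<close>), proved by Gaussian summation and the continuity of translations in \<open>L\<^sup>2\<close>, and the
  completeness of \<open>L\<^sup>2\<close> (\<open>L2_complete\<close>), by which the transform extends to all square integrable functions
  (\<open>mfrft_exists\<close>).
\<close>

section \<open>Square integrable functions\<close>

lemma borel_measurable_continuous_lebesgue:
  fixes f :: "'a::euclidean_space \<Rightarrow> 'b::topological_space"
  assumes "continuous_on UNIV f"
  shows "f \<in> borel_measurable lebesgue"
  using borel_measurable_continuous_onI[OF assms] by (intro measurable_completion) simp

lemma L2norm_nonneg: "0 \<le> L2norm f"
  by (simp add: L2norm_def)

lemma L2norm_sq: "(L2norm f)\<^sup>2 = (LINT x|lebesgue. (cmod (f x))\<^sup>2)"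
  by (simp add: L2norm_def)

lemma square_integrable_measurable [measurable_dest]:
  "square_integrable f \<Longrightarrow> f \<in> borel_measurable lebesgue"
  by (simp add: square_integrable_def)

lemma nn_integral_square:
  assumes "square_integrable f"
  shows "(\<integral>\<^sup>+ x. ennreal ((cmod (f x))\<^sup>2) \<partial>lebesgue) = ennreal ((L2norm f)\<^sup>2)"
  using assms unfolding L2norm_sq square_integrable_def
  by (intro nn_integral_eq_integral) auto

text \<open>
  The nonnegative integral makes sense for every measurable \<open>f\<close>, so a bound coming from Fatou's lemma
  yields membership in \<open>L\<^sup>2\<close> and a bound on the norm at once.
\<close>

lemma square_integrableI:
  fixes f :: "real ^ 'n \<Rightarrow> complex"
  assumes "f \<in> borel_measurable lebesgue"
    and "(\<integral>\<^sup>+ x. ennreal ((cmod (f x))\<^sup>2) \<partial>lebesgue) \<le> ennreal C" "0 \<le> C"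
  shows "square_integrable f" "(L2norm f)\<^sup>2 \<le> C"
proof -
  have [measurable]: "f \<in> borel_measurable lebesgue" by fact
  have "(\<integral>\<^sup>+ x. ennreal ((cmod (f x))\<^sup>2) \<partial>lebesgue) < \<infinity>"
    using assms(2) by (simp add: order_le_less_trans)
  then show sq: "square_integrable f"
    unfolding square_integrable_def by (auto intro!: integrableI_bounded)
  show "(L2norm f)\<^sup>2 \<le> C"
    using assms(2,3) unfolding nn_integral_square[OF sq] by simp
qed

lemma square_integrable_bound:
  fixes f g :: "real ^ 'n \<Rightarrow> complex"
  assumes g: "square_integrable g" and f: "f \<in> borel_measurable lebesgue"
    and le: "AE x in lebesgue. cmod (f x) \<le> C * cmod (g x)"
  shows "square_integrable f"
proof -
  have [measurable]: "f \<in> borel_measurable lebesgue" by fact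
  have "integrable lebesgue (\<lambda>x. C\<^sup>2 * (cmod (g x))\<^sup>2)"
    using g by (simp add: square_integrable_def)
  then have "integrable lebesgue (\<lambda>x. (cmod (f x))\<^sup>2)"
  proof (rule Bochner_Integration.integrable_bound)
    show "AE x in lebesgue. norm ((cmod (f x))\<^sup>2) \<le> norm (C\<^sup>2 * (cmod (g x))\<^sup>2)"
      using le by eventually_elim (metis abs_power2 norm_ge_zero norm_power power_mono power_mult_distrib real_norm_def norm_mult)
  qed measurable
  then show ?thesis using f by (simp add: square_integrable_def)
qed

lemma L2norm_mono:
  fixes f g :: "real ^ 'n \<Rightarrow> complex"
  assumes "square_integrable f" "square_integrable g"
    and "AE x in lebesgue. cmod (f x) \<le> cmod (g x)"
  shows "L2norm f \<le> L2norm g"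
  unfolding L2norm_def using assms
  by (auto simp: square_integrable_def intro!: integral_mono_AE power_mono)

lemma L2norm_cmult: "L2norm (\<lambda>x. c * f x) = cmod c * L2norm f"
  by (simp add: L2norm_def norm_mult power_mult_distrib real_sqrt_mult)

lemma L2norm_minus_commute: "L2norm (\<lambda>x. f x - g x) = L2norm (\<lambda>x. g x - f x)"
  by (simp add: L2norm_def norm_minus_commute)

lemma square_integrable_cmult:
  "square_integrable f \<Longrightarrow> square_integrable (\<lambda>x. c * f x)"
  by (rule square_integrable_bound[of f _ "cmod c"]) (auto simp: norm_mult)

lemma square_integrable_add:
  fixes f g :: "real ^ 'n \<Rightarrow> complex"
  assumes f: "square_integrable f" and g: "square_integrable g"
  shows "square_integrable (\<lambda>x. f x + g x)"
proof -
  note [measurable] = f g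
  have "integrable lebesgue (\<lambda>x. 2 * (cmod (f x))\<^sup>2 + 2 * (cmod (g x))\<^sup>2)"
    using f g by (simp add: square_integrable_def)
  then have "integrable lebesgue (\<lambda>x. (cmod (f x + g x))\<^sup>2)"
  proof (rule Bochner_Integration.integrable_bound)
    show "AE x in lebesgue. norm ((cmod (f x + g x))\<^sup>2)
        \<le> norm (2 * (cmod (f x))\<^sup>2 + 2 * (cmod (g x))\<^sup>2)"
    proof (rule AE_I2)
      fix x
      have "(cmod (f x + g x))\<^sup>2 \<le> (cmod (f x) + cmod (g x))\<^sup>2"
        by (intro power_mono norm_triangle_ineq) auto
      also have "\<dots> \<le> 2 * (cmod (f x))\<^sup>2 + 2 * (cmod (g x))\<^sup>2"
        using sum_squares_bound[of "cmod (f x)" "cmod (g x)"] by (simp add: power2_sum)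
      finally show "norm ((cmod (f x + g x))\<^sup>2) \<le> norm (2 * (cmod (f x))\<^sup>2 + 2 * (cmod (g x))\<^sup>2)"
        by simp
    qed
  qed measurable
  then show ?thesis by (simp add: square_integrable_def)
qed

lemma square_integrable_diff:
  "square_integrable f \<Longrightarrow> square_integrable g \<Longrightarrow> square_integrable (\<lambda>x. f x - g x)"
  using square_integrable_add[of f "\<lambda>x. (-1) * g x"] square_integrable_cmult[of g "-1"] by simp

lemma integrable_mult_square_integrable:
  fixes f g :: "real ^ 'n \<Rightarrow> complex"
  assumes f: "square_integrable f" and g: "square_integrable g"
  shows "integrable lebesgue (\<lambda>x. cmod (f x) * cmod (g x))"
proof -
  note [measurable] = f g
  have "integrable lebesgue (\<lambda>x. (cmod (f x))\<^sup>2 + (cmod (g x))\<^sup>2)"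
    using f g by (simp add: square_integrable_def)
  then show ?thesis
  proof (rule Bochner_Integration.integrable_bound)
    show "AE x in lebesgue. norm (cmod (f x) * cmod (g x)) \<le> norm ((cmod (f x))\<^sup>2 + (cmod (g x))\<^sup>2)"
    proof (rule AE_I2)
      fix x
      have "0 \<le> cmod (f x) * cmod (g x)" by simp
      then have "cmod (f x) * cmod (g x) \<le> (cmod (f x))\<^sup>2 + (cmod (g x))\<^sup>2"
        using sum_squares_bound[of "cmod (f x)" "cmod (g x)"] by linarith
      then show "norm (cmod (f x) * cmod (g x)) \<le> norm ((cmod (f x))\<^sup>2 + (cmod (g x))\<^sup>2)" by simp
    qed
  qed measurable
qed

lemma L2norm_Cauchy_Schwarz:
  fixes f g :: "real ^ 'n \<Rightarrow> complex"
  assumes f: "square_integrable f" and g: "square_integrable g"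
  shows "(LINT x|lebesgue. cmod (f x) * cmod (g x)) \<le> L2norm f * L2norm g"
proof -
  note [measurable] = f g
  let ?I = "LINT x|lebesgue. cmod (f x) * cmod (g x)"
  have I0: "0 \<le> ?I" by simp
  have "ennreal (?I\<^sup>2) = (\<integral>\<^sup>+x. ennreal (cmod (f x)) * ennreal (cmod (g x)) \<partial>lebesgue)\<^sup>2"
    using integrable_mult_square_integrable[OF f g] I0
    by (subst ennreal_power[symmetric])
       (auto simp: ennreal_mult[symmetric] intro!: arg_cong[where f="\<lambda>x. x ^ 2"] nn_integral_eq_integral[symmetric])
  also have "\<dots> \<le> (\<integral>\<^sup>+x. (ennreal (cmod (f x)))\<^sup>2 \<partial>lebesgue) * (\<integral>\<^sup>+x. (ennreal (cmod (g x)))\<^sup>2 \<partial>lebesgue)"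
    by (intro Cauchy_Schwarz_nn_integral) measurable
  also have "\<dots> = ennreal ((L2norm f)\<^sup>2) * ennreal ((L2norm g)\<^sup>2)"
    by (simp add: ennreal_power nn_integral_square f g)
  also have "\<dots> = ennreal ((L2norm f * L2norm g)\<^sup>2)"
    by (simp add: ennreal_mult power_mult_distrib)
  finally have "?I\<^sup>2 \<le> (L2norm f * L2norm g)\<^sup>2" by simp
  then show ?thesis by (rule power2_le_imp_le) (simp add: L2norm_nonneg)
qed

lemma L2norm_triangle:
  fixes f g :: "real ^ 'n \<Rightarrow> complex"
  assumes f: "square_integrable f" and g: "square_integrable g"
  shows "L2norm (\<lambda>x. f x + g x) \<le> L2norm f + L2norm g"
proof -
  note fg = square_integrable_add[OF f g]
  note [measurable] = f g
  have "(L2norm (\<lambda>x. f x + g x))\<^sup>2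
      \<le> (LINT x|lebesgue. (cmod (f x))\<^sup>2 + 2 * (cmod (f x) * cmod (g x)) + (cmod (g x))\<^sup>2)"
    unfolding L2norm_sq
  proof (rule integral_mono)
    fix x
    have "(cmod (f x + g x))\<^sup>2 \<le> (cmod (f x) + cmod (g x))\<^sup>2"
      by (intro power_mono norm_triangle_ineq) auto
    then show "(cmod (f x + g x))\<^sup>2 \<le> (cmod (f x))\<^sup>2 + 2 * (cmod (f x) * cmod (g x)) + (cmod (g x))\<^sup>2"
      by (simp add: power2_sum algebra_simps)
  qed (use f g fg integrable_mult_square_integrable[OF f g] in \<open>auto simp: square_integrable_def\<close>)
  also have "\<dots> = (L2norm f)\<^sup>2 + 2 * (LINT x|lebesgue. cmod (f x) * cmod (g x)) + (L2norm g)\<^sup>2"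
    using f g integrable_mult_square_integrable[OF f g] by (simp add: square_integrable_def L2norm_sq)
  also have "\<dots> \<le> (L2norm f)\<^sup>2 + 2 * (L2norm f * L2norm g) + (L2norm g)\<^sup>2"
    using L2norm_Cauchy_Schwarz[OF f g] by simp
  also have "\<dots> = (L2norm f + L2norm g)\<^sup>2" by (simp add: power2_sum)
  finally show ?thesis by (rule power2_le_imp_le) (simp add: L2norm_nonneg)
qed

lemma L2norm_triangle_diff:
  fixes f g :: "real ^ 'n \<Rightarrow> complex"
  assumes f: "square_integrable f" and g: "square_integrable g"
  shows "L2norm (\<lambda>x. f x - g x) \<le> L2norm f + L2norm g"
  using L2norm_triangle[OF f square_integrable_cmult[OF g, of "-1"]] L2norm_cmult[of "-1" g] by simp

lemma L2norm_triangle3: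
  fixes f g h :: "real ^ 'n \<Rightarrow> complex"
  assumes "square_integrable f" "square_integrable g" "square_integrable h"
  shows "L2norm (\<lambda>x. f x - h x) \<le> L2norm (\<lambda>x. f x - g x) + L2norm (\<lambda>x. g x - h x)"
  using L2norm_triangle[of "\<lambda>x. f x - g x" "\<lambda>x. g x - h x"] assms
  by (simp add: square_integrable_diff)

section \<open>Diagonal affine changes of variables\<close>

lemma
  fixes d t :: "real ^ 'n"
  defines "T \<equiv> \<lambda>x::real^'n. \<chi> k. t $ k + d $ k * x $ k"
  assumes d: "\<And>k. d $ k \<noteq> 0"
  shows lebesgue_diag: "lebesgue = density (distr lebesgue lebesgue T) (\<lambda>_. ennreal (\<Prod>k\<in>UNIV. \<bar>d $ k\<bar>))"
    and measurable_diag: "T \<in> lebesgue \<rightarrow>\<^sub>M lebesgue"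
proof -
  define c where "c = (\<lambda>j::real^'n. d \<bullet> j)"
  have B: "(Basis :: (real^'n) set) = range (\<lambda>k. axis k 1)"
    by (auto simp: Basis_vec_def)
  have inj: "inj (\<lambda>k::'n. axis k (1::real))" by (auto simp: inj_def axis_eq_axis)
  have c: "c j \<noteq> 0" if "j \<in> Basis" for j
    using that d by (auto simp: c_def B inner_axis)
  have T: "T = (\<lambda>x. t + (\<Sum>j\<in>Basis. (c j * (x \<bullet> j)) *\<^sub>R j))"
    unfolding T_def B sum.reindex[OF inj] c_def
    by (simp add: vec_eq_iff fun_eq_iff inner_axis) (simp add: axis_def if_distrib cong: if_cong)
  have p: "(\<Prod>j\<in>Basis. \<bar>c j\<bar>) = (\<Prod>k\<in>UNIV. \<bar>d $ k\<bar>)"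
    unfolding B prod.reindex[OF inj] by (simp add: c_def inner_axis)
  show "lebesgue = density (distr lebesgue lebesgue T) (\<lambda>_. ennreal (\<Prod>k\<in>UNIV. \<bar>d $ k\<bar>))"
    using lebesgue_affine_euclidean[of c t, OF c] p unfolding T by simp
  show "T \<in> lebesgue \<rightarrow>\<^sub>M lebesgue"
    using lebesgue_affine_measurable[of c t, OF c] unfolding T by simp
qed

lemma integral_diag:
  fixes d t :: "real ^ 'n" and h :: "real ^ 'n \<Rightarrow> 'b::{banach, second_countable_topology}"
  assumes "\<And>k. d $ k \<noteq> 0" and h: "h \<in> borel_measurable lebesgue"
  shows "integral\<^sup>L lebesgue h
    = (\<Prod>k\<in>UNIV. \<bar>d $ k\<bar>) *\<^sub>R (LINT x|lebesgue. h (\<chi> k. t $ k + d $ k * x $ k))"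
  using measurable_diag[of d t, OF assms(1)] h
  by (subst lebesgue_diag[of d t, OF assms(1)])
     (auto simp: integral_density integral_distr prod_nonneg)

lemma integrable_diag:
  fixes d t :: "real ^ 'n" and h :: "real ^ 'n \<Rightarrow> 'b::{banach, second_countable_topology}"
  assumes d: "\<And>k. d $ k \<noteq> 0" and h: "h \<in> borel_measurable lebesgue"
  shows "integrable lebesgue (\<lambda>x. h (\<chi> k. t $ k + d $ k * x $ k)) \<longleftrightarrow> integrable lebesgue h"
proof -
  have "(\<Prod>k\<in>UNIV. \<bar>d $ k\<bar>) \<noteq> 0" using d by simp
  then have "integrable lebesgue g \<longleftrightarrow> integrable lebesgue (\<lambda>x. (\<Prod>k\<in>UNIV. \<bar>d $ k\<bar>) *\<^sub>R g x)"
    for g :: "real ^ 'n \<Rightarrow> 'b"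
    using integrable_scaleR_right[of "1 / (\<Prod>k\<in>UNIV. \<bar>d $ k\<bar>)" lebesgue "\<lambda>x. (\<Prod>k\<in>UNIV. \<bar>d $ k\<bar>) *\<^sub>R g x"]
    by auto
  then show ?thesis using measurable_diag[of d t, OF assms(1)] h
    by (subst (2) lebesgue_diag[of d t, OF assms(1)])
       (simp add: integrable_density integrable_distr_eq prod_nonneg del: prod_zero_iff)
qed

lemma borel_measurable_shift:
  assumes "u \<in> borel_measurable lebesgue"
  shows "(\<lambda>x::real^'n. u (x + z)) \<in> borel_measurable lebesgue"
proof -
  have "(\<chi> k. z $ k + 1 $ k * x $ k) = x + z" for x :: "real^'n"
    by (simp add: vec_eq_iff)
  with measurable_compose[OF measurable_diag[of 1 z] assms] show ?thesis by simp
qed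

lemma integral_shift:
  fixes u :: "real ^ 'n \<Rightarrow> 'b::{banach, second_countable_topology}"
  assumes "u \<in> borel_measurable lebesgue"
  shows "(LINT x|lebesgue. u (x + z)) = integral\<^sup>L lebesgue u"
proof -
  have "(\<chi> k. z $ k + 1 $ k * x $ k) = x + z" for x :: "real^'n"
    by (simp add: vec_eq_iff)
  with integral_diag[of 1 u z] assms show ?thesis by simp
qed

lemma integrable_shift:
  fixes u :: "real ^ 'n \<Rightarrow> 'b::{banach, second_countable_topology}"
  assumes "u \<in> borel_measurable lebesgue"
  shows "integrable lebesgue (\<lambda>x. u (x + z)) \<longleftrightarrow> integrable lebesgue u"
proof -
  have "(\<chi> k. z $ k + 1 $ k * x $ k) = x + z" for x :: "real^'n"
    by (simp add: vec_eq_iff)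
  with integrable_diag[of 1 u z] assms show ?thesis by simp
qed

lemma square_integrable_shift:
  "square_integrable u \<Longrightarrow> square_integrable (\<lambda>x. u (x + z))"
  unfolding square_integrable_def
  by (auto simp: integrable_shift[of "\<lambda>x. (cmod (u x))\<^sup>2"] intro: borel_measurable_shift)

lemma L2norm_shift:
  "square_integrable u \<Longrightarrow> L2norm (\<lambda>x. u (x + z)) = L2norm u"
  unfolding L2norm_def square_integrable_def
  by (auto simp: integral_shift[of "\<lambda>x. (cmod (u x))\<^sup>2"])

section \<open>Continuity of translations and truncation\<close>

text \<open>
  Enclose \<open>A\<close> in an open \<open>U\<close> of almost the same measure. For \<open>x \<in> A\<close> the points \<open>x + z n\<close> are eventually
  in \<open>U\<close>, so dominated convergence gives that \<open>A\<close> and \<open>U - z n\<close> overlap in almost the measure of \<open>A\<close>.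
  Only this one-sided semicontinuity is available for an open set, but it is enough, because \<open>A\<close> and its
  translate have the same measure.
\<close>

lemma integral_translate_indicator_tendsto:
  fixes A :: "(real ^ 'n) set" and z :: "nat \<Rightarrow> real ^ 'n"
  assumes A: "A \<in> lmeasurable" and z: "z \<longlonglongrightarrow> 0"
  shows "(\<lambda>n. LINT x|lebesgue. \<bar>indicat_real A (x + z n) - indicat_real A x\<bar>) \<longlonglongrightarrow> 0"
proof (rule LIMSEQ_I)
  fix e :: real assume e: "0 < e"
  have [measurable]: "A \<in> sets lebesgue" using A by auto
  obtain U where U: "open U" "A \<subseteq> U" "U - A \<in> lmeasurable" "emeasure lebesgue (U - A) < ennreal (e/4)"
    using sets_lebesgue_outer_open[of A "e/4"] e by auto
  have [measurable]: "U \<in> sets lebesgue" using U(1) by auto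
  have Um: "U \<in> lmeasurable"
    using fmeasurable.Un[OF A U(3)] U(2) by (simp add: Un_absorb1)
  have iA: "integrable lebesgue (indicat_real A)" and iU: "integrable lebesgue (indicat_real U)"
    using A Um by (auto simp: lmeasurable_iff_integrable)
  have mU: "measure lebesgue U - measure lebesgue A < e/4"
  proof -
    have "measure lebesgue (U - A) < e/4"
      using U(4) e U(3) by (simp add: emeasure_eq_measure2 ennreal_less_iff)
    then show ?thesis using U(2) A Um by (simp add: measurable_measure_Diff)
  qed
  have shm: "(\<lambda>x. indicat_real S (x + w)) \<in> borel_measurable lebesgue" if "S \<in> sets lebesgue" for S and w :: "real^'n"
    using that by (intro borel_measurable_shift) auto
  note [measurable] = shm[of A] shm[of U]
  have lim: "(\<lambda>n. LINT x|lebesgue. indicat_real A x * indicat_real U (x + z n))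
      \<longlonglongrightarrow> (LINT x|lebesgue. indicat_real A x * indicat_real U x)"
  proof (rule integral_dominated_convergence[where w="indicat_real A"])
    show "AE x in lebesgue. (\<lambda>n. indicat_real A x * indicat_real U (x + z n))
        \<longlonglongrightarrow> indicat_real A x * indicat_real U x"
    proof (rule AE_I2)
      fix x :: "real^'n"
      show "(\<lambda>n. indicat_real A x * indicat_real U (x + z n)) \<longlonglongrightarrow> indicat_real A x * indicat_real U x"
      proof (cases "x \<in> A")
        case True
        then have "x \<in> U" using U by auto
        have "(\<lambda>n. x + z n) \<longlonglongrightarrow> x + 0" by (intro tendsto_intros z)
        then have "\<forall>\<^sub>F n in sequentially. x + z n \<in> U"
          using topological_tendstoD[OF _ U(1)] \<open>x \<in> U\<close> by fastforce
        then show ?thesis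
          by (intro tendsto_eventually, elim eventually_mono) (simp add: \<open>x \<in> U\<close>)
      qed auto
    qed
    show "AE x in lebesgue. norm (indicat_real A x * indicat_real U (x + z n)) \<le> indicat_real A x" for n
      by (auto simp: indicator_def)
  qed (use iA in measurable)
  have AU: "(LINT x|lebesgue. indicat_real A x * indicat_real U x) = measure lebesgue A"
  proof -
    have "(\<lambda>x. indicat_real A x * indicat_real U x) = indicat_real A"
      using U(2) by (auto simp: indicator_def fun_eq_iff)
    then show ?thesis by simp
  qed
  have bound: "(LINT x|lebesgue. \<bar>indicat_real A (x + z n) - indicat_real A x\<bar>)
      \<le> 2 * (measure lebesgue U - (LINT x|lebesgue. indicat_real A x * indicat_real U (x + z n)))" for n
  proof -
    have iAs: "integrable lebesgue (\<lambda>x. indicat_real A (x + z n))"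
      and iUs: "integrable lebesgue (\<lambda>x. indicat_real U (x + z n))"
      using iA iU by (simp_all add: integrable_shift)
    have iAU: "integrable lebesgue (\<lambda>x. indicat_real A x * indicat_real U (x + z n))"
    proof (rule Bochner_Integration.integrable_bound[OF iA])
      show "AE x in lebesgue. norm (indicat_real A x * indicat_real U (x + z n)) \<le> norm (indicat_real A x)"
        by (auto simp: indicator_def)
    qed measurable
    have eqs: "(LINT x|lebesgue. indicat_real A (x + z n)) = measure lebesgue A"
       "(LINT x|lebesgue. indicat_real U (x + z n)) = measure lebesgue U"
       using integral_shift[of "indicat_real A" "z n"] integral_shift[of "indicat_real U" "z n"] by auto
    have "(LINT x|lebesgue. \<bar>indicat_real A (x + z n) - indicat_real A x\<bar>)
      \<le> (LINT x|lebesgue. indicat_real A x + 2 * indicat_real U (x + z n) - indicat_real A (x + z n)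
           - 2 * (indicat_real A x * indicat_real U (x + z n)))"
    proof (rule integral_mono)
      show "\<bar>indicat_real A (x + z n) - indicat_real A x\<bar>
          \<le> indicat_real A x + 2 * indicat_real U (x + z n) - indicat_real A (x + z n)
             - 2 * (indicat_real A x * indicat_real U (x + z n))" for x
          using U(2) by (auto simp: indicator_def)
    qed (use iA iAs iUs iAU in auto)
    also have "\<dots> = measure lebesgue A + 2 * measure lebesgue U - measure lebesgue A
        - 2 * (LINT x|lebesgue. indicat_real A x * indicat_real U (x + z n))"
      using iA iAs iUs iAU by (simp add: eqs)
    finally show ?thesis by simp
  qed
  have "\<forall>\<^sub>F n in sequentially. measure lebesgue A - e/4
      < (LINT x|lebesgue. indicat_real A x * indicat_real U (x + z n))"
    using order_tendstoD(1)[OF lim] e by (simp add: AU)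
  then obtain N where N: "\<And>n. n \<ge> N \<Longrightarrow> measure lebesgue A - e/4
      < (LINT x|lebesgue. indicat_real A x * indicat_real U (x + z n))"
    by (auto simp: eventually_sequentially)
  show "\<exists>N. \<forall>n\<ge>N. norm ((LINT x|lebesgue. \<bar>indicat_real A (x + z n) - indicat_real A x\<bar>) - 0) < e"
  proof (intro exI allI impI)
    fix n assume "N \<le> n"
    have "j < e" if "a - e/4 < i" "j \<le> 2 * (u - i)" "u - a < e/4" for a i j u :: real
      using that by (simp add: field_simps)
    from this[OF N[OF \<open>N \<le> n\<close>] bound[of n] mU]
    have "(LINT x|lebesgue. \<bar>indicat_real A (x + z n) - indicat_real A x\<bar>) < e" .
    then show "norm ((LINT x|lebesgue. \<bar>indicat_real A (x + z n) - indicat_real A x\<bar>) - 0) < e"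
      by simp
  qed
qed

text \<open>
  Translation invariance makes the error made by replacing \<open>u\<close> with an approximation uniform in
  the translation, so the property passes from indicators to all integrable functions.
\<close>

lemma integral_translate_tendsto:
  fixes u :: "real ^ 'n \<Rightarrow> complex" and z :: "nat \<Rightarrow> real ^ 'n"
  assumes u: "integrable lebesgue u" and z: "z \<longlonglongrightarrow> 0"
  shows "(\<lambda>n. LINT x|lebesgue. cmod (u (x + z n) - u x)) \<longlonglongrightarrow> 0"
  using u
proof (induct rule: integrable_induct)
  case (base A c)
  then have A: "A \<in> lmeasurable" by (simp add: fmeasurable_def)
  have "(\<lambda>n. cmod c * (LINT x|lebesgue. \<bar>indicat_real A (x + z n) - indicat_real A x\<bar>)) \<longlonglongrightarrow> cmod c * 0"
    by (intro tendsto_intros integral_translate_indicator_tendsto A z)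
  moreover have "cmod (indicat_real A y *\<^sub>R c - indicat_real A x *\<^sub>R c)
      = cmod c * \<bar>indicat_real A y - indicat_real A x\<bar>" for x y
    by (auto simp: indicator_def)
  ultimately show ?case by simp
next
  case (add f g)
  note [measurable] = borel_measurable_integrable[OF add(1)] borel_measurable_integrable[OF add(3)]
  have i: "integrable lebesgue (\<lambda>x. f (x + z n))" "integrable lebesgue (\<lambda>x. g (x + z n))" for n
    using add(1,3) by (simp_all add: integrable_shift)
  have "(\<lambda>n. (LINT x|lebesgue. cmod (f (x + z n) - f x)) + (LINT x|lebesgue. cmod (g (x + z n) - g x))) \<longlonglongrightarrow> 0 + 0"
    by (intro tendsto_add add)
  moreover have "(LINT x|lebesgue. cmod ((f (x + z n) + g (x + z n)) - (f x + g x)))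
      \<le> (LINT x|lebesgue. cmod (f (x + z n) - f x)) + (LINT x|lebesgue. cmod (g (x + z n) - g x))" for n
    using i[of n] add(1,3)
    by (subst Bochner_Integration.integral_add[symmetric])
       (auto intro!: integral_mono simp: add_diff_add norm_triangle_ineq simp del: Bochner_Integration.integral_add)
  ultimately show ?case
    by (auto intro: Lim_null_comparison[OF always_eventually, rotated])
next
  case (lim f s)
  note [measurable] = borel_measurable_integrable[OF lim(1)] borel_measurable_integrable[OF lim(5)]
  have intl: "(\<lambda>i. LINT x|lebesgue. cmod (s i x - f x)) \<longlonglongrightarrow> (LINT x|(lebesgue::(real^'n) measure). 0)"
  proof (rule integral_dominated_convergence[where w="\<lambda>x. 3 * cmod (f x)"])
    show "AE x in lebesgue. (\<lambda>i. cmod (s i x - f x)) \<longlonglongrightarrow> 0"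
      using lim(3) by (intro AE_I2 tendsto_norm_zero) (simp add: LIM_zero)
    \<comment> \<open>The approximating sequence satisfies \<open>|s i x| \<le> 2 |f x|\<close>.\<close>
    show "AE x in lebesgue. norm (cmod (s i x - f x)) \<le> 3 * cmod (f x)" for i
    proof (rule AE_I2)
      fix x :: "real^'n"
      show "norm (cmod (s i x - f x)) \<le> 3 * cmod (f x)"
        using lim(4)[of x i] norm_triangle_ineq4[of "s i x" "f x"] by simp
    qed
  qed (use lim(1,5) in auto)
  show ?case
  proof (rule LIMSEQ_I)
    fix e :: real assume e: "0 < e"
    from order_tendstoD(2)[OF intl, of "e/3"] e
    obtain i where i: "(LINT x|lebesgue. cmod (s i x - f x)) < e/3"
      by (auto simp: eventually_sequentially)
    from LIMSEQ_D[OF lim(2)[of i], of "e/3"] e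
    obtain N where N: "\<And>n. n \<ge> N \<Longrightarrow> (LINT x|lebesgue. cmod (s i (x + z n) - s i x)) < e/3"
      by auto
    show "\<exists>N. \<forall>n\<ge>N. norm ((LINT x|lebesgue. cmod (f (x + z n) - f x)) - 0) < e"
    proof (intro exI allI impI)
      fix n assume n: "N \<le> n"
      have sh: "integrable lebesgue (\<lambda>x. f (x + z n))" "integrable lebesgue (\<lambda>x. s i (x + z n))"
        using lim(1,5) by (simp_all add: integrable_shift)
      have "(LINT x|lebesgue. cmod (f (x + z n) - f x))
         \<le> (LINT x|lebesgue. cmod (s i (x + z n) - f (x + z n)) + cmod (s i (x + z n) - s i x) + cmod (s i x - f x))"
      proof (rule integral_mono)
        fix x
        have "f (x + z n) - f x = - (s i (x + z n) - f (x + z n)) + (s i (x + z n) - s i x) + (s i x - f x)" by simp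
        then show "cmod (f (x + z n) - f x)
            \<le> cmod (s i (x + z n) - f (x + z n)) + cmod (s i (x + z n) - s i x) + cmod (s i x - f x)"
          by (smt (verit) norm_triangle_ineq norm_minus_cancel)
      qed (use sh lim(1,5) in auto)
      also have "\<dots> = (LINT x|lebesgue. cmod (s i (x + z n) - f (x + z n)))
          + (LINT x|lebesgue. cmod (s i (x + z n) - s i x)) + (LINT x|lebesgue. cmod (s i x - f x))"
        using sh lim(1,5) by simp
      also have "(LINT x|lebesgue. cmod (s i (x + z n) - f (x + z n))) = (LINT x|lebesgue. cmod (s i x - f x))"
        by (rule integral_shift[of "\<lambda>x. cmod (s i x - f x)"]) measurable
      finally show "norm ((LINT x|lebesgue. cmod (f (x + z n) - f x)) - 0) < e"
        using i N[OF n] by simp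
    qed
  qed
qed

text \<open>
  The cut-off is both in space and in height: in space it makes a square integrable function
  integrable, and the height bound lets an \<open>L\<^sup>2\<close> distance be controlled by an \<open>L\<^sup>1\<close> distance.
\<close>

definition truncate :: "(real ^ 'n \<Rightarrow> complex) \<Rightarrow> nat \<Rightarrow> real ^ 'n \<Rightarrow> complex" where
  "truncate f n x = (if norm x \<le> real n \<and> cmod (f x) \<le> real n then f x else 0)"

lemma cmod_truncate_le: "cmod (truncate f n x) \<le> cmod (f x)" "cmod (truncate f n x) \<le> real n"
  by (auto simp: truncate_def)

lemma measurable_truncate [measurable]:
  "f \<in> borel_measurable lebesgue \<Longrightarrow> truncate f n \<in> borel_measurable lebesgue"
proof -
  assume [measurable]: "f \<in> borel_measurable lebesgue"
  have [measurable]: "(norm :: real ^ 'a \<Rightarrow> real) \<in> borel_measurable lebesgue"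
    by (rule borel_measurable_continuous_lebesgue) (intro continuous_intros)
  show ?thesis unfolding truncate_def[abs_def] by measurable
qed

lemma square_integrable_truncate:
  "square_integrable f \<Longrightarrow> square_integrable (truncate f n)"
  by (rule square_integrable_bound[of f _ 1]) (auto simp: cmod_truncate_le square_integrable_def)

lemma integrable_truncate:
  assumes "square_integrable f"
  shows "integrable lebesgue (truncate f n)"
proof -
  have [measurable]: "f \<in> borel_measurable lebesgue" using assms by auto
  have "integrable lebesgue (\<lambda>x. real n * indicat_real (cball 0 (real n)) x)"
    by (intro integrable_mult_right) (simp add: lmeasurable_iff_integrable[symmetric])
  then show ?thesis
    by (rule Bochner_Integration.integrable_bound)
       (auto simp: truncate_def indicator_def)
qed

lemma L2_tendsto_truncate:
  assumes f: "square_integrable f"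
  shows "L2_tendsto (truncate f) f"
proof -
  note [measurable] = f
  have "(\<lambda>n. LINT x|lebesgue. (cmod (truncate f n x - f x))\<^sup>2) \<longlonglongrightarrow> (LINT x|(lebesgue::(real^'a) measure). 0)"
  proof (rule integral_dominated_convergence[where w="\<lambda>x. (cmod (f x))\<^sup>2"])
    show "AE x in lebesgue. (\<lambda>n. (cmod (truncate f n x - f x))\<^sup>2) \<longlonglongrightarrow> 0"
    proof (rule AE_I2)
      fix x
      have "\<forall>\<^sub>F n in sequentially. (cmod (truncate f n x - f x))\<^sup>2 = 0"
      proof -
        obtain N :: nat where "max (norm x) (cmod (f x)) \<le> real N" using real_arch_simple by blast
        then show ?thesis
          by (auto simp: eventually_sequentially truncate_def intro!: exI[of _ N])
      qed
      then show "(\<lambda>n. (cmod (truncate f n x - f x))\<^sup>2) \<longlonglongrightarrow> 0" by (rule tendsto_eventually)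
    qed
    show "AE x in lebesgue. norm ((cmod (truncate f n x - f x))\<^sup>2) \<le> (cmod (f x))\<^sup>2" for n
      by (auto simp: truncate_def)
  qed (use f in \<open>auto simp: square_integrable_def\<close>)
  then have "(\<lambda>n. sqrt (LINT x|lebesgue. (cmod (truncate f n x - f x))\<^sup>2)) \<longlonglongrightarrow> sqrt 0"
    by (intro tendsto_real_sqrt) simp
  then show ?thesis
    using f by (simp add: L2_tendsto_def square_integrable_truncate L2norm_def)
qed

lemma L2norm_translate_tendsto:
  fixes u :: "real ^ 'n \<Rightarrow> complex" and z :: "nat \<Rightarrow> real ^ 'n"
  assumes u: "square_integrable u" and z: "z \<longlonglongrightarrow> 0"
  shows "(\<lambda>n. L2norm (\<lambda>x. u (x + z n) - u x)) \<longlonglongrightarrow> 0"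
proof (rule LIMSEQ_I)
  fix e :: real assume e: "0 < e"
  have "(\<lambda>i. L2norm (\<lambda>x. truncate u i x - u x)) \<longlonglongrightarrow> 0"
    using L2_tendsto_truncate[OF u] by (simp add: L2_tendsto_def)
  from LIMSEQ_D[OF this, of "e/3"] e
  obtain i where i: "L2norm (\<lambda>x. truncate u i x - u x) < e/3"
    by (auto simp: L2norm_nonneg)
  define v where "v = truncate u i"
  have v: "square_integrable v" and vi: "integrable lebesgue v"
    unfolding v_def using u by (auto intro: square_integrable_truncate integrable_truncate)
  have bv: "cmod (v x) \<le> real i" for x unfolding v_def by (rule cmod_truncate_le)
  have "(L2norm (\<lambda>x. v (x + z n) - v x))\<^sup>2 \<le> 2 * real i * (LINT x|lebesgue. cmod (v (x + z n) - v x))" for n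
  proof -
    have sq: "square_integrable (\<lambda>x. v (x + z n) - v x)"
      using v by (intro square_integrable_diff square_integrable_shift)
    have int: "integrable lebesgue (\<lambda>x. v (x + z n) - v x)"
      using vi by (simp add: integrable_shift)
    have "(L2norm (\<lambda>x. v (x + z n) - v x))\<^sup>2 \<le> (LINT x|lebesgue. 2 * real i * cmod (v (x + z n) - v x))"
      unfolding L2norm_sq
    proof (rule integral_mono)
      fix x
      have "cmod (v (x + z n) - v x) \<le> 2 * real i"
        using norm_triangle_ineq4[of "v (x + z n)" "v x"] bv[of x] bv[of "x + z n"] by linarith
      then show "(cmod (v (x + z n) - v x))\<^sup>2 \<le> 2 * real i * cmod (v (x + z n) - v x)"
        by (simp add: power2_eq_square mult_right_mono)
    qed (use sq int in \<open>auto simp: square_integrable_def\<close>)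
    then show ?thesis using int by simp
  qed
  moreover have "(\<lambda>n. 2 * real i * (LINT x|lebesgue. cmod (v (x + z n) - v x))) \<longlonglongrightarrow> 2 * real i * 0"
    by (intro tendsto_intros integral_translate_tendsto vi z)
  ultimately have "(\<lambda>n. (L2norm (\<lambda>x. v (x + z n) - v x))\<^sup>2) \<longlonglongrightarrow> 0"
    by (intro Lim_null_comparison[OF always_eventually, of "\<lambda>n. (L2norm (\<lambda>x. v (x + z n) - v x))\<^sup>2"
        "\<lambda>n. 2 * real i * (LINT x|lebesgue. cmod (v (x + z n) - v x))"]) simp_all
  then have "(\<lambda>n. sqrt ((L2norm (\<lambda>x. v (x + z n) - v x))\<^sup>2)) \<longlonglongrightarrow> sqrt 0"
    by (rule tendsto_real_sqrt)
  then have "(\<lambda>n. L2norm (\<lambda>x. v (x + z n) - v x)) \<longlonglongrightarrow> 0" by (simp add: L2norm_nonneg)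
  from LIMSEQ_D[OF this, of "e/3"] e
  obtain N where N: "\<And>n. n \<ge> N \<Longrightarrow> L2norm (\<lambda>x. v (x + z n) - v x) < e/3"
    by (auto simp: L2norm_nonneg)
  show "\<exists>N. \<forall>n\<ge>N. norm (L2norm (\<lambda>x. u (x + z n) - u x) - 0) < e"
  proof (intro exI allI impI)
    fix n assume "N \<le> n"
    have uz: "square_integrable (\<lambda>x. u (x + z n))" and vz: "square_integrable (\<lambda>x. v (x + z n))"
      using u v by (auto intro: square_integrable_shift)
    have "L2norm (\<lambda>x. u (x + z n) - v (x + z n)) = L2norm (\<lambda>x. v x - u x)"
      using L2norm_shift[OF square_integrable_diff[OF u v], of "z n"]
      by (metis L2norm_minus_commute)
    then have "L2norm (\<lambda>x. u (x + z n) - u x) < e"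
      using L2norm_triangle3[OF uz vz u] L2norm_triangle3[OF vz v u] N[OF \<open>N \<le> n\<close>] i[folded v_def]
      by linarith
    then show "norm (L2norm (\<lambda>x. u (x + z n) - u x) - 0) < e" by (simp add: L2norm_nonneg)
  qed
qed

section \<open>Gaussians\<close>

lemma lborel_prod_vec:
  fixes g :: "'n::finite \<Rightarrow> real \<Rightarrow> complex"
  assumes g: "\<And>k. integrable lborel (g k)"
  shows integrable_lborel_prod_vec: "integrable lborel (\<lambda>x::real^'n. \<Prod>k\<in>UNIV. g k (x $ k))"
    and integral_lborel_prod_vec:
      "(LINT x|(lborel :: (real^'n) measure). (\<Prod>k\<in>UNIV. g k (x $ k))) = (\<Prod>k\<in>UNIV. LINT t|lborel. g k t)"
proof -
  interpret product_sigma_finite "\<lambda>_::real^'n. lborel :: real measure" ..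
  have B: "(Basis :: (real^'n) set) = range (\<lambda>k. axis k 1)"
    by (auto simp: Basis_vec_def)
  have inj: "inj (\<lambda>k::'n. axis k (1::real))" by (auto simp: inj_def axis_eq_axis)
  define G where "G = (\<lambda>b::real^'n. g (inv (\<lambda>k. axis k 1) b))"
  have G: "G (axis k 1) = g k" for k by (simp add: G_def inv_f_f[OF inj])
  have Gi: "integrable lborel (G b)" for b by (simp add: G_def g)
  have [measurable]: "G b \<in> borel_measurable borel" for b
    using Gi[of b] by auto
  have [measurable]: "g k \<in> borel_measurable borel" for k
    using g[of k] by auto
  have prod: "(\<Prod>k\<in>UNIV. g k ((\<Sum>b\<in>Basis. f b *\<^sub>R b) $ k)) = (\<Prod>b\<in>Basis. G b (f b))" for f :: "real^'n \<Rightarrow> real"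
  proof -
    have "(\<Sum>b\<in>Basis. f b *\<^sub>R b) $ k = f (axis k 1)" for k
      unfolding B sum.reindex[OF inj] by (simp add: axis_def if_distrib cong: if_cong)
    then show ?thesis unfolding B prod.reindex[OF inj] by (simp add: G)
  qed
  have m: "(\<lambda>f. \<Sum>b\<in>Basis. f b *\<^sub>R b) \<in> (\<Pi>\<^sub>M b\<in>Basis. (lborel :: real measure)) \<rightarrow>\<^sub>M (borel :: (real^'n) measure)"
    by measurable
  have m2: "(\<lambda>x::real^'n. \<Prod>k\<in>UNIV. g k (x $ k)) \<in> borel_measurable borel" by measurable
  show "integrable lborel (\<lambda>x::real^'n. \<Prod>k\<in>UNIV. g k (x $ k))"
    unfolding lborel_eq[where 'a="real^'n"] integrable_distr_eq[OF m m2] prod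
    by (intro product_integrable_prod) (auto simp: Gi)
  show "(LINT x|(lborel :: (real^'n) measure). (\<Prod>k\<in>UNIV. g k (x $ k))) = (\<Prod>k\<in>UNIV. LINT t|lborel. g k t)"
    unfolding lborel_eq[where 'a="real^'n"] integral_distr[OF m m2] prod
    by (subst product_integral_prod) (auto simp: Gi B prod.reindex[OF inj] G)
qed

definition gauss :: "real ^ 'n \<Rightarrow> real" where
  "gauss w = exp (- (norm w)\<^sup>2 / 2) / sqrt (2 * pi) ^ CARD('n)"

lemma gauss_eq_prod: "gauss (w :: real^'n) = (\<Prod>k\<in>UNIV. std_normal_density (w $ k))"
proof -
  have "(norm w)\<^sup>2 = (\<Sum>k\<in>UNIV. (w $ k)\<^sup>2)"
    by (simp add: norm_vec_def L2_set_def sum_nonneg)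
  then show ?thesis
    by (simp add: gauss_def std_normal_density_def prod_dividef exp_sum[symmetric] sum_negf sum_divide_distrib)
qed

lemma gauss_pos: "0 < gauss w" by (simp add: gauss_def)

lemma gauss_measurable [measurable]: "gauss \<in> borel_measurable borel"
  unfolding gauss_def[abs_def] by measurable

lemma cis_inner_vec: "cis (w \<bullet> t) = (\<Prod>k\<in>UNIV. cis ((w $ k) * (t $ k)))" for w t :: "real^'n"
proof -
  have "cis (\<Sum>k\<in>A. a k) = (\<Prod>k\<in>A. cis (a k))" for a :: "'n \<Rightarrow> real" and A
    by (induction A rule: infinite_finite_induct) (auto simp flip: cis_mult)
  then show ?thesis by (simp add: inner_vec_def)
qed

lemma cis_measurable [measurable]: "cis \<in> borel_measurable borel"
  unfolding cis_conv_exp by (intro borel_measurable_continuous_onI continuous_intros)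

lemma std_normal_fourier:
  "integrable lborel (\<lambda>x. complex_of_real (std_normal_density x) * cis (x * t))"
  "(LINT x|lborel. complex_of_real (std_normal_density x) * cis (x * t)) = exp (- t\<^sup>2 / 2)"
proof -
  have i: "integrable lborel (\<lambda>x. complex_of_real (std_normal_density x))"
    by (intro integrable_of_real integrable_normal_density) simp
  show "integrable lborel (\<lambda>x. complex_of_real (std_normal_density x) * cis (x * t))"
    by (rule Bochner_Integration.integrable_bound[OF i]) (auto simp: norm_mult)
  have "char std_normal_distribution t = (LINT x|lborel. std_normal_density x *\<^sub>R iexp (t * x))"
    unfolding char_def by (subst integral_density) auto
  then show "(LINT x|lborel. complex_of_real (std_normal_density x) * cis (x * t)) = exp (- t\<^sup>2 / 2)"
    unfolding char_std_normal_distribution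
    by (simp add: scaleR_conv_of_real cis_conv_exp mult.commute mult.left_commute)
qed

text \<open>
  The integral splits into coordinates, each of which contributes the characteristic function of the
  standard normal distribution.
\<close>

lemma gauss_fourier:
  fixes t :: "real^'n"
  shows "integrable lborel (\<lambda>w. complex_of_real (gauss w) * cis (w \<bullet> t))"
    and "(LINT w|lborel. complex_of_real (gauss w) * cis (w \<bullet> t)) = of_real (sqrt (2 * pi) ^ CARD('n) * gauss t)"
proof -
  have eq: "complex_of_real (gauss w) * cis (w \<bullet> t)
      = (\<Prod>k\<in>UNIV. complex_of_real (std_normal_density (w $ k)) * cis (w $ k * t $ k))" for w :: "real^'n"
    by (simp add: gauss_eq_prod cis_inner_vec prod.distrib)
  show "integrable lborel (\<lambda>w. complex_of_real (gauss w) * cis (w \<bullet> t))"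
    unfolding eq by (rule integrable_lborel_prod_vec) (rule std_normal_fourier)
  have "(LINT w|lborel. complex_of_real (gauss w) * cis (w \<bullet> t)) = (\<Prod>k\<in>UNIV. of_real (exp (- (t $ k)\<^sup>2 / 2)))"
    unfolding eq by (subst integral_lborel_prod_vec) (simp_all only: std_normal_fourier)
  also have "\<dots> = of_real (sqrt (2 * pi) ^ CARD('n) * gauss t)"
    by (simp add: gauss_eq_prod std_normal_density_def prod_dividef)
  finally show "(LINT w|lborel. complex_of_real (gauss w) * cis (w \<bullet> t)) = of_real (sqrt (2 * pi) ^ CARD('n) * gauss t)" .
qed

lemma gauss_integrable: "integrable lborel (gauss :: real^'n \<Rightarrow> real)"
  and gauss_integral: "(LINT w|lborel. gauss (w :: real^'n)) = 1"
proof -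
  show i: "integrable lborel (gauss :: real^'n \<Rightarrow> real)"
    using integrable_norm[OF gauss_fourier(1)[of "0::real^'n"]]
    by (simp add: norm_mult less_imp_le[OF gauss_pos])
  have "complex_of_real (LINT w|lborel. gauss (w :: real^'n)) = (LINT w|lborel. complex_of_real (gauss (w :: real^'n)) * cis (w \<bullet> 0))"
    by simp
  also have "\<dots> = complex_of_real 1"
    unfolding gauss_fourier(2) by (simp add: gauss_def)
  finally show "(LINT w|lborel. gauss (w :: real^'n)) = 1"
    by (simp only: of_real_eq_iff)
qed

section \<open>Plancherel's theorem\<close>

definition fourier :: "(real ^ 'n \<Rightarrow> complex) \<Rightarrow> real ^ 'n \<Rightarrow> complex" where
  "fourier u \<eta> = (LINT x|lebesgue. u x * cis (- (x \<bullet> \<eta>)))"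

lemma cnj_measurable [measurable]: "cnj \<in> borel_measurable borel"
  by (intro borel_measurable_continuous_onI continuous_intros)

lemma integrable_pair_bound:
  fixes F :: "'a::euclidean_space \<times> 'a \<Rightarrow> complex" and a b :: "'a \<Rightarrow> real"
  assumes F: "F \<in> borel_measurable (lborel \<Otimes>\<^sub>M lborel)"
    and a: "integrable lborel a" and b: "integrable lborel b"
    and le: "\<And>x y. cmod (F (x, y)) \<le> a x * b y"
  shows "integrable (lborel \<Otimes>\<^sub>M lborel) F"
proof -
  note [measurable] = borel_measurable_integrable[OF a] borel_measurable_integrable[OF b]
  have "integrable (lborel \<Otimes>\<^sub>M lborel) (\<lambda>(x, y). a x * b y)"
  proof (rule lborel_pair.Fubini_integrable)
    show "(\<lambda>(x, y). a x * b y) \<in> borel_measurable (lborel \<Otimes>\<^sub>M lborel)" by measurable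
    have "integrable lborel (\<lambda>x. \<bar>a x\<bar> * (LINT y|lborel. \<bar>b y\<bar>))"
      using a by simp
    then show "integrable lborel (\<lambda>x. LINT y|lborel. norm (case (x, y) of (x, y) \<Rightarrow> a x * b y))"
      by (simp add: abs_mult)
  qed (use b in simp)
  then show ?thesis
  proof (rule Bochner_Integration.integrable_bound)
    show "AE z in lborel \<Otimes>\<^sub>M lborel. norm (F z) \<le> norm (case z of (x, y) \<Rightarrow> a x * b y)"
      using le by (intro AE_I2) (auto simp: split_beta intro: order_trans[OF _ abs_ge_self])
  qed (rule F)
qed

lemma lborel_diag:
  fixes h :: "real ^ 'n \<Rightarrow> complex" and t :: "real ^ 'n"
  assumes [measurable]: "h \<in> borel_measurable borel" and s: "s > 0"
  shows "integral\<^sup>L lborel h = of_real (s ^ CARD('n)) * (LINT w|lborel. h (t + s *\<^sub>R w))"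
proof -
  have "integral\<^sup>L lborel h = integral\<^sup>L lebesgue h"
    by (simp add: integral_completion)
  also have "\<dots> = of_real (s ^ CARD('n)) * (LINT w|lebesgue. h (\<chi> k. t $ k + s * w $ k))"
    using s by (subst integral_diag[of "\<chi> k. s" _ t]) (simp_all add: scaleR_conv_of_real measurable_completion)
  also have "(\<lambda>w::real^'n. h (\<chi> k. t $ k + s * w $ k)) = (\<lambda>w. h (t + s *\<^sub>R w))"
    by (intro ext arg_cong[where f=h]) (simp add: vec_eq_iff)
  also have "(LINT w|lebesgue. h (t + s *\<^sub>R w)) = (LINT w|lborel. h (t + s *\<^sub>R w))"
    by (intro integral_completion) measurable
  finally show ?thesis .
qed

lemma fourier_lborel:
  assumes [measurable]: "u \<in> borel_measurable borel"
  shows "fourier u \<eta> = (LINT x|lborel. u x * cis (- (x \<bullet> \<eta>)))"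
proof -
  have "(\<lambda>x. u x * cis (- (x \<bullet> \<eta>))) \<in> borel_measurable lborel" by simp
  then show ?thesis unfolding fourier_def by (rule integral_completion)
qed

lemma cmod_fourier_le:
  assumes "integrable lborel u"
  shows "cmod (fourier u \<eta>) \<le> (LINT x|lborel. cmod (u x))"
proof -
  have [measurable]: "u \<in> borel_measurable borel" using assms by auto
  show ?thesis
    using integral_norm_bound[of lborel "\<lambda>x. u x * cis (- (x \<bullet> \<eta>))"]
    by (simp add: fourier_lborel norm_mult)
qed

lemma fourier_measurable_borel [measurable]:
  assumes [measurable]: "u \<in> borel_measurable borel"
  shows "fourier u \<in> borel_measurable borel"
proof -
  have "(\<lambda>\<eta>. LINT x|lborel. u x * cis (- (x \<bullet> \<eta>))) \<in> borel_measurable borel"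
    by measurable
  then show ?thesis by (simp add: fourier_lborel[OF assms, symmetric])
qed

text \<open>
  In terms of \<open>autocorr u\<close>, Plancherel's theorem is Fourier inversion at the origin:
  up to a reflection of the frequency, \<open>|fourier u|\<^sup>2\<close> is the transform of \<open>autocorr u\<close>, whose value at \<open>0\<close> is the squared norm of \<open>u\<close>.
\<close>

definition autocorr :: "(real ^ 'n \<Rightarrow> complex) \<Rightarrow> real ^ 'n \<Rightarrow> complex" where
  "autocorr u z = (LINT x|lebesgue. u x * cnj (u (x + z)))"

lemma integrable_autocorr:
  assumes "square_integrable u"
  shows "integrable lebesgue (\<lambda>x. u x * cnj (u (x + z)))"
proof -
  note [measurable] = square_integrable_measurable[OF assms]
    square_integrable_measurable[OF square_integrable_shift[OF assms, of z]]
  show ?thesis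
    by (rule Bochner_Integration.integrable_bound[OF
          integrable_mult_square_integrable[OF assms square_integrable_shift[OF assms, of z]]])
       (auto simp: norm_mult)
qed

lemma integral_cmod_autocorr_le:
  assumes "square_integrable u"
  shows "(LINT x|lebesgue. cmod (u x) * cmod (u (x + z))) \<le> (L2norm u)\<^sup>2"
  using L2norm_Cauchy_Schwarz[OF assms square_integrable_shift[OF assms, of z]]
  by (simp add: L2norm_shift[OF assms] power2_eq_square)

lemma autocorr_le:
  assumes "square_integrable u"
  shows "cmod (autocorr u z) \<le> (L2norm u)\<^sup>2"
  using integral_norm_bound[of lebesgue "\<lambda>x. u x * cnj (u (x + z))"]
    integral_cmod_autocorr_le[OF assms, of z]
  by (simp add: autocorr_def norm_mult)

text \<open>
  The autocorrelation is continuous at the origin because translations are continuous in \<open>L\<^sup>2\<close>.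
\<close>

lemma autocorr_tendsto:
  assumes u: "square_integrable u" and z: "z \<longlonglongrightarrow> 0"
  shows "(\<lambda>n. autocorr u (z n)) \<longlonglongrightarrow> of_real ((L2norm u)\<^sup>2)"
proof -
  have 0: "autocorr u 0 = of_real ((L2norm u)\<^sup>2)"
    unfolding autocorr_def L2norm_sq add_0_right complex_norm_square[symmetric]
    by (rule integral_complex_of_real)
  have "cmod (autocorr u (z n) - autocorr u 0) \<le> L2norm u * L2norm (\<lambda>x. u (x + z n) - u x)" for n
  proof -
    have sq: "square_integrable (\<lambda>x. u (x + z n) - u x)"
      by (intro square_integrable_diff square_integrable_shift u)
    have "autocorr u (z n) - autocorr u 0 = (LINT x|lebesgue. u x * cnj (u (x + z n) - u x))"
      using integrable_autocorr[OF u, of "z n"] integrable_autocorr[OF u, of 0]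
      by (simp add: autocorr_def algebra_simps)
    also have "cmod \<dots> \<le> (LINT x|lebesgue. cmod (u x) * cmod (u (x + z n) - u x))"
      using integral_norm_bound[of lebesgue "\<lambda>x. u x * cnj (u (x + z n) - u x)"]
      by (simp only: norm_mult complex_mod_cnj)
    also have "\<dots> \<le> L2norm u * L2norm (\<lambda>x. u (x + z n) - u x)"
      by (rule L2norm_Cauchy_Schwarz[OF u sq])
    finally show ?thesis .
  qed
  moreover have "(\<lambda>n. L2norm u * L2norm (\<lambda>x. u (x + z n) - u x)) \<longlonglongrightarrow> L2norm u * 0"
    by (intro tendsto_intros L2norm_translate_tendsto u z)
  ultimately have "(\<lambda>n. autocorr u (z n) - autocorr u 0) \<longlonglongrightarrow> 0"
    by (intro Lim_null_comparison[OF always_eventually, of "\<lambda>n. autocorr u (z n) - autocorr u 0"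
       "\<lambda>n. L2norm u * L2norm (\<lambda>x. u (x + z n) - u x)"]) simp_all
  then show ?thesis by (simp add: LIM_zero_iff 0)
qed

lemma gauss_scaled_integrable:
  assumes "s > 0"
  shows "integrable lborel (\<lambda>\<eta>::real^'n. gauss (s *\<^sub>R \<eta>))"
proof -
  have e: "(\<lambda>\<eta>::real^'n. gauss (\<chi> k. 0 $ k + (\<chi> k. s) $ k * \<eta> $ k)) = (\<lambda>\<eta>. gauss (s *\<^sub>R \<eta>))"
    by (intro ext arg_cong[where f=gauss]) (simp add: vec_eq_iff)
  have "integrable lebesgue (\<lambda>\<eta>::real^'n. gauss (s *\<^sub>R \<eta>))"
    using integrable_diag[of "\<chi> k. s" "gauss :: real^'n \<Rightarrow> real" 0] gauss_integrable assms
    unfolding e by (simp add: integrable_completion measurable_completion)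
  then show ?thesis by (simp add: integrable_completion)
qed

lemma gauss_scaled_fourier:
  fixes w :: "real ^ 'n"
  assumes s: "s > 0"
  shows "of_real (s ^ CARD('n)) * (LINT \<eta>|lborel. of_real (gauss (s *\<^sub>R \<eta>)) * cis (s *\<^sub>R w \<bullet> \<eta>))
    = of_real (sqrt (2 * pi) ^ CARD('n) * gauss w)"
proof -
  have m: "(\<lambda>v. complex_of_real (gauss v) * cis (v \<bullet> w)) \<in> borel_measurable borel" by measurable
  have "of_real (s ^ CARD('n)) * (LINT \<eta>|lborel. of_real (gauss (0 + s *\<^sub>R \<eta>)) * cis ((0 + s *\<^sub>R \<eta>) \<bullet> w))
    = (LINT v|lborel. complex_of_real (gauss v) * cis (v \<bullet> w))"
    by (rule lborel_diag[OF m s, symmetric])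
  moreover have "(0 + s *\<^sub>R \<eta>) \<bullet> w = s *\<^sub>R w \<bullet> \<eta>" for \<eta>
    by (simp add: inner_commute)
  ultimately show ?thesis by (simp only: gauss_fourier(2) add_0_left)
qed

text \<open>
  The Gaussian weight makes all integrals absolutely convergent. Expanding the square as two integrals over
  \<open>x\<close> and \<open>y\<close> and integrating over \<open>\<eta>\<close> first leaves a Gaussian of width \<open>s\<close> in \<open>y - x\<close>; the substitution
  \<open>y = x + s w\<close> turns it into a Gaussian mean of the autocorrelation near the origin.

  The function \<open>u\<close> has to be Borel measurable here, since \<open>(x, w) \<mapsto> u (x + s w)\<close> need not be measurable for the
  product of two completed measures if \<open>u\<close> is only Lebesgue measurable.
\<close>

lemma gaussian_mean_fourier:
  fixes u :: "real ^ 'n \<Rightarrow> complex"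
  assumes ui: "integrable lborel u" and u2: "square_integrable u" and s: "0 < s"
  shows "(LINT \<eta>|lborel. complex_of_real ((cmod (fourier u \<eta>))\<^sup>2 * gauss (s *\<^sub>R \<eta>)))
       = of_real (sqrt (2 * pi) ^ CARD('n)) * (LINT w|lborel. of_real (gauss w) * autocorr u (s *\<^sub>R w))"
proof -
  let ?g = "\<lambda>\<eta>::real^'n. gauss (s *\<^sub>R \<eta>)"
  let ?F = "fourier u"
  have [measurable]: "u \<in> borel_measurable borel" using ui by auto
  define U where "U = (LINT x|lborel. cmod (u x))"
  have FU: "cmod (?F \<eta>) \<le> U" for \<eta> unfolding U_def by (rule cmod_fourier_le[OF ui])
  have g0: "0 \<le> ?g \<eta>" for \<eta> by (rule less_imp_le[OF gauss_pos])
  note gi = gauss_scaled_integrable[OF s, where 'n='n]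
  define S where "S = (\<lambda>z. LINT \<eta>|lborel. of_real (?g \<eta>) * cis (z \<bullet> \<eta>))"
  have Sm[measurable]: "S \<in> borel_measurable borel" unfolding S_def by measurable
  have "(LINT \<eta>|lborel. complex_of_real ((cmod (?F \<eta>))\<^sup>2 * ?g \<eta>))
      = (LINT \<eta>|lborel. (LINT x|lborel. u x * cis (- (x \<bullet> \<eta>)) * (cnj (?F \<eta>) * of_real (?g \<eta>))))"
    unfolding integral_mult_left_zero fourier_lborel[OF \<open>u \<in> borel_measurable borel\<close>, symmetric]
    by (simp add: complex_norm_square del: of_real_power) (simp add: mult.assoc)
  also have "\<dots> = (LINT x|lborel. (LINT \<eta>|lborel. u x * cis (- (x \<bullet> \<eta>)) * (cnj (?F \<eta>) * of_real (?g \<eta>))))"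
  proof (rule lborel_pair.Fubini_integral, rule integrable_pair_bound)
    show "integrable lborel (\<lambda>x. cmod (u x))" "integrable lborel (\<lambda>\<eta>. U * ?g \<eta>)"
      using ui gi by simp_all
    show "cmod (case (x, \<eta>) of (x, \<eta>) \<Rightarrow> u x * cis (- (x \<bullet> \<eta>)) * (cnj (?F \<eta>) * of_real (?g \<eta>))) \<le> cmod (u x) * (U * ?g \<eta>)" for x \<eta>
      using g0[of \<eta>] FU[of \<eta>] by (auto simp: norm_mult intro!: mult_left_mono mult_right_mono)
  qed measurable
  also have "\<dots> = (LINT x|lborel. u x * (LINT \<eta>|lborel. (LINT y|lborel. cnj (u y) * (of_real (?g \<eta>) * cis ((y - x) \<bullet> \<eta>)))))"
  proof -
    have c: "cnj (?F \<eta>) = (LINT y|lborel. cnj (u y) * cis (y \<bullet> \<eta>))" for \<eta>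
    proof -
      have "(LINT y|lborel. cnj (u y) * cis (y \<bullet> \<eta>)) = (LINT y|lborel. cnj (u y * cis (- (y \<bullet> \<eta>))))"
        by (simp only: complex_cnj_mult cis_cnj minus_minus)
      then show ?thesis
        unfolding fourier_lborel[OF \<open>u \<in> borel_measurable borel\<close>] by (simp only: Bochner_Integration.integral_cnj)
    qed
    have "u x * cis (- (x \<bullet> \<eta>)) * (cnj (?F \<eta>) * of_real (?g \<eta>))
       = u x * (LINT y|lborel. cnj (u y) * (of_real (?g \<eta>) * cis ((y - x) \<bullet> \<eta>)))" for x \<eta>
    proof -
      have "(LINT y|lborel. cnj (u y) * (of_real (?g \<eta>) * cis ((y - x) \<bullet> \<eta>)))
         = (LINT y|lborel. (of_real (?g \<eta>) * cis (- (x \<bullet> \<eta>))) * (cnj (u y) * cis (y \<bullet> \<eta>)))"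
      proof (intro Bochner_Integration.integral_cong refl)
        fix y
        have "cis ((y - x) \<bullet> \<eta>) = cis (y \<bullet> \<eta>) * cis (- (x \<bullet> \<eta>))"
          by (simp add: inner_diff_left cis_mult)
        then show "cnj (u y) * (of_real (?g \<eta>) * cis ((y - x) \<bullet> \<eta>))
            = (of_real (?g \<eta>) * cis (- (x \<bullet> \<eta>))) * (cnj (u y) * cis (y \<bullet> \<eta>))"
          by (simp only: mult_ac)
      qed
      also have "\<dots> = (of_real (?g \<eta>) * cis (- (x \<bullet> \<eta>))) * cnj (?F \<eta>)"
        unfolding c by simp
      finally show ?thesis by (simp add: mult_ac)
    qed
    then show ?thesis by (simp only: integral_mult_right_zero)
  qed
  also have "\<dots> = (LINT x|lborel. u x * (LINT y|lborel. (LINT \<eta>|lborel. cnj (u y) * (of_real (?g \<eta>) * cis ((y - x) \<bullet> \<eta>)))))"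
  proof -
    have "(LINT \<eta>|lborel. (LINT y|lborel. cnj (u y) * (of_real (?g \<eta>) * cis ((y - x) \<bullet> \<eta>))))
        = (LINT y|lborel. (LINT \<eta>|lborel. cnj (u y) * (of_real (?g \<eta>) * cis ((y - x) \<bullet> \<eta>))))" for x
    proof (rule lborel_pair.Fubini_integral, rule integrable_pair_bound)
      show "integrable lborel (\<lambda>y. cmod (u y))" "integrable lborel ?g"
        using ui gi by simp_all
      show "cmod (case (y, \<eta>) of (y, \<eta>) \<Rightarrow> cnj (u y) * (of_real (?g \<eta>) * cis ((y - x) \<bullet> \<eta>))) \<le> cmod (u y) * ?g \<eta>" for y \<eta>
        using g0[of \<eta>] by (simp add: norm_mult)
    qed measurable
    then show ?thesis by (simp only:)
  qed
  also have "\<dots> = (LINT x|lborel. u x * (LINT y|lborel. cnj (u y) * S (y - x)))"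
    by (simp add: S_def)
  also have "\<dots> = (LINT x|lborel. u x * (LINT w|lborel. cnj (u (x + s *\<^sub>R w)) * of_real (sqrt (2 * pi) ^ CARD('n) * gauss w)))"
  proof -
    have "(LINT y|lborel. cnj (u y) * S (y - x))
        = (LINT w|lborel. cnj (u (x + s *\<^sub>R w)) * of_real (sqrt (2 * pi) ^ CARD('n) * gauss w))" for x
    proof -
      have "(LINT y|lborel. cnj (u y) * S (y - x))
          = of_real (s ^ CARD('n)) * (LINT w|lborel. cnj (u (x + s *\<^sub>R w)) * S (s *\<^sub>R w))"
        using s by (subst lborel_diag[of _ s x]) simp_all
      also have "\<dots> = (LINT w|lborel. cnj (u (x + s *\<^sub>R w)) * (of_real (s ^ CARD('n)) * S (s *\<^sub>R w)))"
        by (simp add: mult.left_commute)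
      finally show ?thesis unfolding S_def gauss_scaled_fourier[OF s] .
    qed
    then show ?thesis by (simp only:)
  qed
  also have "\<dots> = (LINT x|lborel. (LINT w|lborel. of_real (sqrt (2 * pi) ^ CARD('n)) * (of_real (gauss w) * (u x * cnj (u (x + s *\<^sub>R w))))))"
    unfolding integral_mult_right_zero[symmetric]
    by (intro Bochner_Integration.integral_cong refl) (simp add: mult_ac)
  also have "\<dots> = of_real (sqrt (2 * pi) ^ CARD('n)) * (LINT x|lborel. (LINT w|lborel. of_real (gauss w) * (u x * cnj (u (x + s *\<^sub>R w)))))"
    by (simp only: integral_mult_right_zero)
  also have "(LINT x|lborel. (LINT w|lborel. of_real (gauss w) * (u x * cnj (u (x + s *\<^sub>R w)))))
      = (LINT w|lborel. (LINT x|lborel. of_real (gauss w) * (u x * cnj (u (x + s *\<^sub>R w)))))"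
  proof (rule lborel_pair.Fubini_integral, rule lborel_pair.Fubini_integrable)
    have int: "integrable lborel (\<lambda>x. cmod (u x) * cmod (u (x + s *\<^sub>R w)))"
      and le: "(LINT x|lborel. cmod (u x) * cmod (u (x + s *\<^sub>R w))) \<le> (L2norm u)\<^sup>2" for w
      using integrable_norm[OF integrable_autocorr[OF u2, of "s *\<^sub>R w"]]
        integral_cmod_autocorr_le[OF u2, of "s *\<^sub>R w"]
      by (simp_all add: integrable_completion integral_completion norm_mult)
    show "integrable lborel (\<lambda>w. LINT x|lborel. norm (case (w, x) of (w, x) \<Rightarrow> of_real (gauss w) * (u x * cnj (u (x + s *\<^sub>R w)))))"
    proof (rule Bochner_Integration.integrable_bound)
      show "integrable lborel (\<lambda>w::real^'n. gauss w * (L2norm u)\<^sup>2)"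
        using gauss_integrable[where 'n='n] by simp
      show "AE w in lborel. norm (LINT x|lborel. norm (case (w, x) of (w, x) \<Rightarrow> of_real (gauss w) * (u x * cnj (u (x + s *\<^sub>R w))))) \<le> norm (gauss w * (L2norm u)\<^sup>2)"
        using le by (intro AE_I2) (simp add: norm_mult abs_mult mult_left_mono)
    qed measurable
    have "integrable lborel (\<lambda>x. complex_of_real (gauss w) * (u x * cnj (u (x + s *\<^sub>R w))))" for w
      using integrable_autocorr[OF u2, of "s *\<^sub>R w"] by (simp add: integrable_completion)
    then show "AE w in lborel. integrable lborel (\<lambda>x. case (w, x) of (w, x) \<Rightarrow> of_real (gauss w) * (u x * cnj (u (x + s *\<^sub>R w))))"
      by simp
  qed measurable
  also have "\<dots> = (LINT w|lborel. of_real (gauss w) * autocorr u (s *\<^sub>R w))"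
    by (simp add: autocorr_def integral_completion)
  finally show ?thesis .
qed


text \<open>
  Let \<open>s\<close> tend to \<open>0\<close> in the preceding identity. The left hand side increases to a multiple of the
  integral of \<open>|fourier u|\<^sup>2\<close>, and the right hand side tends to a multiple of \<open>autocorr u 0\<close> by dominated
  convergence. In particular, square integrability of the transform comes out of the proof.
\<close>

lemma plancherel_borel:
  fixes u :: "real ^ 'n \<Rightarrow> complex"
  assumes ui: "integrable lborel u" and u2: "square_integrable u"
  shows "integrable lborel (\<lambda>\<eta>. (cmod (fourier u \<eta>))\<^sup>2)"
    and "(LINT \<eta>|lborel. (cmod (fourier u \<eta>))\<^sup>2) = (2 * pi) ^ CARD('n) * (L2norm u)\<^sup>2"
proof -
  have um[measurable]: "u \<in> borel_measurable borel" using ui by auto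
  define U where "U = (LINT x|lborel. cmod (u x))"
  define R where "R = sqrt (2 * pi) ^ CARD('n)"
  define s where "s = (\<lambda>n. inverse (real (Suc n)))"
  have s0: "s n > 0" for n by (simp add: s_def)
  have slim: "s \<longlonglongrightarrow> 0" unfolding s_def by (rule LIMSEQ_inverse_real_of_nat)
  have smono: "s n \<le> s m" if "m \<le> n" for m n using that by (simp add: s_def)
  have R0: "R > 0" by (simp add: R_def)
  have FU: "cmod (fourier u \<eta>) \<le> U" for \<eta> unfolding U_def by (rule cmod_fourier_le[OF ui])
  define A where "A = (\<lambda>n. LINT w|lborel. complex_of_real (gauss w) * autocorr u (s n *\<^sub>R w))"
  have Alim: "A \<longlonglongrightarrow> (LINT w::real^'n|lborel. complex_of_real (gauss w) * of_real ((L2norm u)\<^sup>2))"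
    unfolding A_def
  proof (rule integral_dominated_convergence[where w="\<lambda>w. gauss w * (L2norm u)\<^sup>2"])
    have "autocorr u z = (LINT x|lborel. u x * cnj (u (x + z)))" for z
      unfolding autocorr_def by (intro integral_completion) simp
    then have [measurable]: "autocorr u \<in> borel_measurable borel"
      by (subst measurable_cong) measurable
    show "(\<lambda>w. complex_of_real (gauss w) * autocorr u (s n *\<^sub>R w)) \<in> borel_measurable lborel" for n
      by measurable
    show "AE w in lborel. (\<lambda>n. complex_of_real (gauss w) * autocorr u (s n *\<^sub>R w))
        \<longlonglongrightarrow> complex_of_real (gauss w) * of_real ((L2norm u)\<^sup>2)"
      using slim by (intro AE_I2 tendsto_intros autocorr_tendsto u2 tendsto_eq_intros) auto
    show "AE w in lborel. cmod (complex_of_real (gauss w) * autocorr u (s n *\<^sub>R w)) \<le> gauss w * (L2norm u)\<^sup>2" for n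
      by (intro AE_I2) (auto simp: norm_mult less_imp_le[OF gauss_pos] intro!: mult_mono autocorr_le[OF u2])
  qed (use gauss_integrable in auto)
  have gA: "(LINT w::real^'n|lborel. complex_of_real (gauss w) * of_real ((L2norm u)\<^sup>2)) = of_real ((L2norm u)\<^sup>2)"
    using gauss_integral[where 'n='n] by (simp flip: of_real_mult del: of_real_power)
  from Alim have Alim: "A \<longlonglongrightarrow> of_real ((L2norm u)\<^sup>2)" by (simp only: gA)
  have eq: "(LINT \<eta>|lborel. (cmod (fourier u \<eta>))\<^sup>2 * gauss (s n *\<^sub>R \<eta>)) = R * Re (A n)" for n
    using gaussian_mean_fourier[OF ui u2 s0[of n], THEN arg_cong[where f=Re]]
    unfolding integral_complex_of_real by (simp add: A_def R_def flip: of_real_power)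
  have lim: "(\<lambda>n. LINT \<eta>|lborel. (cmod (fourier u \<eta>))\<^sup>2 * gauss (s n *\<^sub>R \<eta>)) \<longlonglongrightarrow> R * (L2norm u)\<^sup>2"
    unfolding eq using tendsto_Re[OF Alim] by (intro tendsto_intros) simp
  have mono: "gauss (s m *\<^sub>R \<eta>) \<le> gauss (s n *\<^sub>R \<eta>)" if "m \<le> n" for m n and \<eta> :: "real^'n"
  proof -
    have "(norm (s n *\<^sub>R \<eta>))\<^sup>2 \<le> (norm (s m *\<^sub>R \<eta>))\<^sup>2"
      using smono[OF that] s0[of m] s0[of n] by (intro power_mono) (auto intro: mult_right_mono)
    then show ?thesis unfolding gauss_def by (intro divide_right_mono) auto
  qed
  have int: "integrable lborel (\<lambda>\<eta>. (cmod (fourier u \<eta>))\<^sup>2 * gauss (s n *\<^sub>R \<eta>))" for n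
  proof (rule Bochner_Integration.integrable_bound)
    show "integrable lborel (\<lambda>\<eta>::real^'n. U\<^sup>2 * gauss (s n *\<^sub>R \<eta>))"
      using gauss_scaled_integrable[OF s0, where 'n='n] by simp
    show "AE \<eta> in lborel. norm ((cmod (fourier u \<eta>))\<^sup>2 * gauss (s n *\<^sub>R \<eta>)) \<le> norm (U\<^sup>2 * gauss (s n *\<^sub>R \<eta>))"
      using FU by (intro AE_I2) (auto simp: abs_mult intro!: mult_right_mono power_mono)
  qed measurable
  have g0: "(\<lambda>n. gauss (s n *\<^sub>R \<eta>)) \<longlonglongrightarrow> 1 / R" for \<eta> :: "real^'n"
  proof -
    have "(\<lambda>n. gauss (s n *\<^sub>R \<eta>)) \<longlonglongrightarrow> exp (- (norm (0 *\<^sub>R \<eta>))\<^sup>2 / 2) / sqrt (2 * pi) ^ CARD('n)"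
      unfolding gauss_def by (intro tendsto_intros slim) auto
    then show ?thesis by (simp add: R_def)
  qed
  have lims: "integrable lborel (\<lambda>\<eta>. (cmod (fourier u \<eta>))\<^sup>2 * (1 / R))"
    "(LINT \<eta>|lborel. (cmod (fourier u \<eta>))\<^sup>2 * (1 / R)) = R * (L2norm u)\<^sup>2"
  proof (rule_tac [1-2] integral_monotone_convergence_nonneg[where f="\<lambda>n \<eta>. (cmod (fourier u \<eta>))\<^sup>2 * gauss (s n *\<^sub>R \<eta>)"])
    show "AE \<eta> in lborel. mono (\<lambda>n. (cmod (fourier u \<eta>))\<^sup>2 * gauss (s n *\<^sub>R \<eta>))"
      by (intro AE_I2 monoI mult_left_mono mono) auto
    then show "AE \<eta> in lborel. mono (\<lambda>n. (cmod (fourier u \<eta>))\<^sup>2 * gauss (s n *\<^sub>R \<eta>))" .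
    show "AE \<eta> in lborel. 0 \<le> (cmod (fourier u \<eta>))\<^sup>2 * gauss (s n *\<^sub>R \<eta>)" for n
      by (simp add: less_imp_le[OF gauss_pos])
    then show "AE \<eta> in lborel. 0 \<le> (cmod (fourier u \<eta>))\<^sup>2 * gauss (s n *\<^sub>R \<eta>)" for n .
    show "AE \<eta> in lborel. (\<lambda>n. (cmod (fourier u \<eta>))\<^sup>2 * gauss (s n *\<^sub>R \<eta>)) \<longlonglongrightarrow> (cmod (fourier u \<eta>))\<^sup>2 * (1 / R)"
      by (intro AE_I2 tendsto_intros g0)
    then show "AE \<eta> in lborel. (\<lambda>n. (cmod (fourier u \<eta>))\<^sup>2 * gauss (s n *\<^sub>R \<eta>)) \<longlonglongrightarrow> (cmod (fourier u \<eta>))\<^sup>2 * (1 / R)" .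
  qed (use int lim in \<open>measurable\<close>)
  have RR: "R * R = (2 * pi) ^ CARD('n)"
  proof -
    have "R * R = (sqrt (2 * pi) * sqrt (2 * pi)) ^ CARD('n)"
      by (simp only: R_def power_mult_distrib)
    also have "sqrt (2 * pi) * sqrt (2 * pi) = 2 * pi" by (rule real_sqrt_mult_self[THEN trans]) simp
    finally show ?thesis .
  qed
  show "integrable lborel (\<lambda>\<eta>. (cmod (fourier u \<eta>))\<^sup>2)"
    using integrable_mult_right[OF lims(1), of R] R0 by simp
  from lims(2) R0 have "(LINT \<eta>|lborel. (cmod (fourier u \<eta>))\<^sup>2) = R * R * (L2norm u)\<^sup>2"
    by (simp add: divide_eq_eq mult_ac)
  then show "(LINT \<eta>|lborel. (cmod (fourier u \<eta>))\<^sup>2) = (2 * pi) ^ CARD('n) * (L2norm u)\<^sup>2"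
    by (simp add: RR)
qed

lemma lebesgue_borel_representative:
  fixes u :: "real ^ 'n \<Rightarrow> complex"
  assumes "u \<in> borel_measurable lebesgue"
  obtains v where "v \<in> borel_measurable borel" "AE x in lebesgue. u x = v x"
proof -
  have [measurable]: "u \<in> borel_measurable lebesgue" by fact
  have "(\<lambda>x. Re (u x)) \<in> borel_measurable lebesgue" "(\<lambda>x. Im (u x)) \<in> borel_measurable lebesgue"
    by measurable
  from this[THEN completion_ex_borel_measurable_real] obtain a b where
    [measurable]: "a \<in> borel_measurable lborel" "b \<in> borel_measurable lborel"
    and ae: "AE x in lborel. Re (u x) = a x" "AE x in lborel. Im (u x) = b x" by blast
  show thesis
  proof
    show "(\<lambda>x. Complex (a x) (b x)) \<in> borel_measurable borel"
      unfolding Complex_eq by measurable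
    show "AE x in lebesgue. u x = Complex (a x) (b x)"
      using AE_completion[OF ae(1)] AE_completion[OF ae(2)] by eventually_elim (simp add: complex_eq_iff)
  qed
qed

lemma L2norm_cong_AE:
  assumes "u \<in> borel_measurable lebesgue" "v \<in> borel_measurable lebesgue" "AE x in lebesgue. u x = v x"
  shows "L2norm u = L2norm v"
proof -
  note [measurable] = assms(1,2)
  have "(LINT x|lebesgue. (cmod (u x))\<^sup>2) = (LINT x|lebesgue. (cmod (v x))\<^sup>2)"
    using assms(3) by (intro integral_cong_AE) auto
  then show ?thesis by (simp add: L2norm_def)
qed

theorem plancherel:
  fixes u :: "real ^ 'n \<Rightarrow> complex"
  assumes ui: "integrable lebesgue u" and u2: "square_integrable u"
  shows "square_integrable (fourier u)" "(L2norm (fourier u))\<^sup>2 = (2 * pi) ^ CARD('n) * (L2norm u)\<^sup>2"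
proof -
  have um: "u \<in> borel_measurable lebesgue" using ui by auto
  obtain v where v: "v \<in> borel_measurable borel" "AE x in lebesgue. u x = v x"
    using lebesgue_borel_representative[OF um] .
  have vm: "v \<in> borel_measurable lebesgue" using v by (simp add: measurable_completion)
  have [measurable]: "(\<lambda>x. cis (- (x \<bullet> \<eta>))) \<in> borel_measurable lebesgue" for \<eta> :: "real^'n"
    by (intro measurable_completion) simp
  note [measurable] = um vm v(1)
  have F: "fourier u = fourier v"
  proof
    fix \<eta>
    have "AE x in lebesgue. u x * cis (- (x \<bullet> \<eta>)) = v x * cis (- (x \<bullet> \<eta>))"
      using v(2) by eventually_elim simp
    then show "fourier u \<eta> = fourier v \<eta>"
      unfolding fourier_def by (intro integral_cong_AE) auto
  qed
  have N: "L2norm u = L2norm v" by (rule L2norm_cong_AE[OF um vm v(2)])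
  have vi: "integrable lborel v"
    using integrable_cong_AE_imp[OF ui vm] v(2) v(1) by (auto simp: integrable_completion)
  have v2: "square_integrable v"
    using v(2) by (intro square_integrable_bound[OF u2 vm, of 1]) auto
  note P = plancherel_borel[OF vi v2]
  show "square_integrable (fourier u)"
    unfolding square_integrable_def F using P(1) by (simp add: integrable_completion measurable_completion)
  show "(L2norm (fourier u))\<^sup>2 = (2 * pi) ^ CARD('n) * (L2norm u)\<^sup>2"
    unfolding N F L2norm_sq[of "fourier v"] P(2)[symmetric] by (intro integral_completion) measurable
qed

section \<open>Completeness of the space of square integrable functions\<close>

text \<open>
  Along a subsequence the increments \<open>D k\<close> have norm at most \<open>(1/4)^k\<close>. Then \<open>\<Sum>k. 2^k |D k|\<^sup>2\<close> is integrable,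
  hence finite almost everywhere, and \<open>|D k| \<le> (1/2)^k + 2^k |D k|\<^sup>2\<close> shows that the subsequence converges
  almost everywhere. Fatou's lemma turns this into convergence of the whole sequence in norm.
\<close>

theorem L2_complete:
  fixes w :: "nat \<Rightarrow> real ^ 'n \<Rightarrow> complex"
  assumes w: "\<And>n. square_integrable (w n)"
    and cauchy: "\<And>e. 0 < e \<Longrightarrow> \<exists>N. \<forall>m\<ge>N. \<forall>n\<ge>N. L2norm (\<lambda>x. w m x - w n x) \<le> e"
  shows "\<exists>g. L2_tendsto w g"
proof -
  note [measurable] = square_integrable_measurable[OF w]
  have "\<forall>k. \<exists>N. \<forall>m\<ge>N. \<forall>n\<ge>N. L2norm (\<lambda>x. w m x - w n x) \<le> (1/4::real) ^ k"
    by (intro allI cauchy) simp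
  then obtain r where r: "\<And>k m n. r k \<le> m \<Longrightarrow> r k \<le> n \<Longrightarrow> L2norm (\<lambda>x. w m x - w n x) \<le> (1/4::real) ^ k"
    by metis
  \<comment> \<open>The sum only serves to obtain increasing indices that dominate \<open>r\<close>.\<close>
  define R where "R = (\<lambda>k::nat. k + (\<Sum>j\<le>k. r j))"
  have Rr: "r k \<le> R k" "k \<le> R k" for k
    unfolding R_def using member_le_sum[of k "{..k}" r] by auto
  have Rmono: "R k \<le> R (Suc k)" for k by (simp add: R_def)
  define W where "W = (\<lambda>k. w (R k))"
  define D where "D = (\<lambda>k x. W (Suc k) x - W k x)"
  have D2: "square_integrable (D k)" for k unfolding D_def W_def by (intro square_integrable_diff w)
  have [measurable]: "W k \<in> borel_measurable lebesgue" "D k \<in> borel_measurable lebesgue" for k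
    using square_integrable_measurable[OF D2[of k]] by (auto simp: W_def)
  have Dn: "L2norm (D k) \<le> (1/4) ^ k" for k
    unfolding D_def W_def using Rr[of k] Rmono[of k] by (intro r) auto
  have "(\<integral>\<^sup>+x. (\<Sum>k. ennreal (2 ^ k * (cmod (D k x))\<^sup>2)) \<partial>lebesgue)
      = (\<Sum>k. \<integral>\<^sup>+x. ennreal (2 ^ k * (cmod (D k x))\<^sup>2) \<partial>lebesgue)"
    by (intro nn_integral_suminf) measurable
  also have "\<dots> = (\<Sum>k. ennreal (2 ^ k * (L2norm (D k))\<^sup>2))"
    by (simp add: ennreal_mult nn_integral_cmult nn_integral_square[OF D2])
  also have "\<dots> \<le> (\<Sum>k. ennreal ((1/2) ^ k))"
  proof (intro suminf_le summableI ennreal_leI)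
    fix k
    have "(L2norm (D k))\<^sup>2 \<le> ((1/4) ^ k)\<^sup>2" by (intro power_mono Dn L2norm_nonneg)
    then have "2 ^ k * (L2norm (D k))\<^sup>2 \<le> 2 ^ k * ((1/4) ^ k * (1/4) ^ k)"
      by (simp add: power2_eq_square)
    also have "\<dots> = (1/8) ^ k" by (simp flip: power_mult_distrib)
    also have "\<dots> \<le> (1/2) ^ k" by (intro power_mono) auto
    finally show "2 ^ k * (L2norm (D k))\<^sup>2 \<le> (1/2) ^ k" .
  qed
  also have "\<dots> < \<infinity>"
    by (subst suminf_ennreal2) (auto intro: summable_geometric)
  finally have "AE x in lebesgue. (\<Sum>k. ennreal (2 ^ k * (cmod (D k x))\<^sup>2)) \<noteq> \<infinity>"
    by (intro nn_integral_PInf_AE) auto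
  then have conv: "AE x in lebesgue. convergent (\<lambda>k. W k x)"
  proof eventually_elim
    case (elim x)
    then have s: "summable (\<lambda>k. 2 ^ k * (cmod (D k x))\<^sup>2)"
      by (intro summable_suminf_not_top) auto
    have "summable (\<lambda>k. D k x)"
    proof (rule summable_comparison_test')
      show "summable (\<lambda>k. (1/2) ^ k + 2 ^ k * (cmod (D k x))\<^sup>2)"
        by (intro summable_add s summable_geometric) simp
      show "norm (D k x) \<le> (1/2) ^ k + 2 ^ k * (cmod (D k x))\<^sup>2" for k
      proof (cases "cmod (D k x) \<le> (1/2) ^ k")
        case False
        have "cmod (D k x) = 2 ^ k * ((1/2) ^ k * cmod (D k x))"
          by (simp add: power_one_over)
        also have "\<dots> \<le> 2 ^ k * (cmod (D k x) * cmod (D k x))"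
          using False by (intro mult_left_mono mult_right_mono) auto
        finally show ?thesis by (simp add: power2_eq_square add_increasing)
      qed (simp add: add_increasing2)
    qed
    then have "convergent (\<lambda>n. \<Sum>k<n. D k x)" by (simp add: summable_iff_convergent)
    then have "convergent (\<lambda>n. W n x - W 0 x)"
      by (simp only: D_def sum_lessThan_telescope[of "\<lambda>k. W k x"])
    then show ?case
      by (simp add: convergent_diff_const_right_iff)
  qed
  define g where "g = (\<lambda>x. lim (\<lambda>k. W k x))"
  have [measurable]: "g \<in> borel_measurable lebesgue" unfolding g_def by measurable
  have lim: "AE x in lebesgue. (\<lambda>k. W k x) \<longlonglongrightarrow> g x"
    using conv unfolding g_def by eventually_elim (simp add: convergent_LIMSEQ_iff)
  have fatou: "square_integrable (\<lambda>x. w n x - g x) \<and> L2norm (\<lambda>x. w n x - g x) \<le> e"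
    if e: "0 < e" and N: "\<forall>m\<ge>N. \<forall>n\<ge>N. L2norm (\<lambda>x. w m x - w n x) \<le> e" and n: "N \<le> n" for e N n
  proof -
    have "(\<integral>\<^sup>+x. ennreal ((cmod (w n x - g x))\<^sup>2) \<partial>lebesgue)
        = (\<integral>\<^sup>+x. liminf (\<lambda>k. ennreal ((cmod (w n x - W k x))\<^sup>2)) \<partial>lebesgue)"
    proof (rule nn_integral_cong_AE)
      show "AE x in lebesgue. ennreal ((cmod (w n x - g x))\<^sup>2) = liminf (\<lambda>k. ennreal ((cmod (w n x - W k x))\<^sup>2))"
        using lim by eventually_elim (intro lim_imp_Liminf[symmetric] tendsto_ennrealI tendsto_intros, auto)
    qed
    also have "\<dots> \<le> liminf (\<lambda>k. \<integral>\<^sup>+x. ennreal ((cmod (w n x - W k x))\<^sup>2) \<partial>lebesgue)"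
      by (rule nn_integral_liminf) measurable
    also have "\<dots> \<le> ennreal (e\<^sup>2)"
    proof (rule Liminf_le)
      show "\<forall>\<^sub>F k in sequentially. (\<integral>\<^sup>+x. ennreal ((cmod (w n x - W k x))\<^sup>2) \<partial>lebesgue) \<le> ennreal (e\<^sup>2)"
        using eventually_ge_at_top[of N]
      proof eventually_elim
        case (elim k)
        then have "L2norm (\<lambda>x. w n x - W k x) \<le> e"
          using N n Rr(2)[of k] unfolding W_def by auto
        then show ?case
          unfolding W_def nn_integral_square[OF square_integrable_diff[OF w w]]
          by (intro ennreal_leI power_mono L2norm_nonneg)
      qed
    qed simp
    finally have le: "(\<integral>\<^sup>+x. ennreal ((cmod (w n x - g x))\<^sup>2) \<partial>lebesgue) \<le> ennreal (e\<^sup>2)" .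
    have "(L2norm (\<lambda>x. w n x - g x))\<^sup>2 \<le> e\<^sup>2" by (rule square_integrableI(2)[OF _ le]) auto
    moreover have "square_integrable (\<lambda>x. w n x - g x)" by (rule square_integrableI(1)[OF _ le]) auto
    ultimately show ?thesis using e by (auto intro: power2_le_imp_le)
  qed
  have g2: "square_integrable g"
  proof -
    obtain N where "\<forall>m\<ge>N. \<forall>n\<ge>N. L2norm (\<lambda>x. w m x - w n x) \<le> 1" using cauchy[of 1] by auto
    then have "square_integrable (\<lambda>x. w N x - g x)" using fatou[of 1 N N] by auto
    from square_integrable_diff[OF w[of N] this] show ?thesis by simp
  qed
  have "(\<lambda>n. L2norm (\<lambda>x. w n x - g x)) \<longlonglongrightarrow> 0"
  proof (rule LIMSEQ_I)
    fix e :: real assume "0 < e"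
    then obtain N where "\<forall>m\<ge>N. \<forall>n\<ge>N. L2norm (\<lambda>x. w m x - w n x) \<le> e/2" using cauchy[of "e/2"] by auto
    from fatou[OF _ this] \<open>0 < e\<close> have "\<forall>n\<ge>N. L2norm (\<lambda>x. w n x - g x) \<le> e/2" by auto
    with \<open>0 < e\<close> show "\<exists>N. \<forall>n\<ge>N. norm (L2norm (\<lambda>x. w n x - g x) - 0) < e"
      by (intro exI[of _ N]) (fastforce simp: L2norm_nonneg)
  qed
  then show ?thesis using w g2 by (auto simp: L2_tendsto_def)
qed

section \<open>The fractional transform as a rescaled Fourier transform\<close>

definition mfrft_freq :: "real ^ 'n \<Rightarrow> real \<Rightarrow> real ^ 'n \<Rightarrow> real ^ 'n" where
  "mfrft_freq \<alpha> lam \<xi> = (\<chi> k. lam\<^sup>2 / sin (\<alpha> $ k) * \<xi> $ k)"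

lemma cmod_chirp [simp]: "cmod (mfrft_chirp \<alpha> lam x) = 1"
  by (simp add: mfrft_chirp_def)

lemma chirp_measurable [measurable]: "mfrft_chirp \<alpha> lam \<in> borel_measurable lebesgue"
  unfolding mfrft_chirp_def[abs_def]
  by (intro borel_measurable_continuous_lebesgue continuous_intros)

lemma cmod_mfrft_c_sq:
  assumes "\<And>k. sin (\<alpha> $ k) \<noteq> 0"
  shows "(cmod (mfrft_c \<alpha>))\<^sup>2 = 1 / abs_sin_prod \<alpha>"
proof -
  have "(cmod (frft_c t))\<^sup>2 = 1 / \<bar>sin t\<bar>" if "sin t \<noteq> 0" for t
  proof -
    have "(cmod (frft_c t))\<^sup>2 = cmod (1 - \<i> * complex_of_real (cot t))"
      unfolding frft_c_def by (metis norm_power power2_csqrt)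
    also have "\<dots> = sqrt (1 + (cot t)\<^sup>2)" by (simp add: cmod_def)
    also have "1 + (cot t)\<^sup>2 = (1 / \<bar>sin t\<bar>)\<^sup>2"
      using that sin_cos_squared_add[of t] by (simp add: cot_def field_simps)
    finally show ?thesis by simp
  qed
  then show ?thesis using assms
    by (simp add: mfrft_c_def abs_sin_prod_def abs_prod prod_dividef prod_power_distrib prod_norm[symmetric])
qed

text \<open>
  The two quadratic phases of the kernel split off as chirps, and its mixed phase is the inner product of \<open>x\<close>
  with \<open>mfrft_freq \<alpha> lam \<xi>\<close>.
\<close>

lemma mfrft_integral_eq_fourier:
  fixes \<alpha> :: "real ^ 'n"
  shows "mfrft_integral \<alpha> lam u \<xi> = mfrft_c \<alpha> / of_real (sqrt (2 * pi) ^ CARD('n)) * mfrft_chirp \<alpha> lam \<xi>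
     * fourier (\<lambda>x. u x * mfrft_chirp \<alpha> lam x) (mfrft_freq \<alpha> lam \<xi>)"
proof -
  have "lam\<^sup>2 * (\<Sum>k\<in>UNIV. x $ k * \<xi> $ k * (1 / sin (\<alpha> $ k))) = x \<bullet> mfrft_freq \<alpha> lam \<xi>" for x :: "real^'n"
    by (simp add: mfrft_freq_def inner_vec_def sum_distrib_left mult_ac)
  then have e: "exp (- \<i> * complex_of_real (lam\<^sup>2 * (\<Sum>k\<in>UNIV. x $ k * \<xi> $ k * (1 / sin (\<alpha> $ k)))))
      = cis (- (x \<bullet> mfrft_freq \<alpha> lam \<xi>))" for x
    by (simp only: cis_conv_exp) simp
  show ?thesis
    unfolding mfrft_integral_def mfrft_kernel_def fourier_def e integral_mult_right_zero[symmetric]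
    by (intro Bochner_Integration.integral_cong refl) (simp only: mult_ac)
qed

lemma mfrft_freq_prod:
  assumes "\<And>k. sin (\<alpha> $ k) \<noteq> 0"
  shows "(\<Prod>k\<in>UNIV. \<bar>lam\<^sup>2 / sin (\<alpha> $ k)\<bar>) = (lam\<^sup>2) ^ CARD('n) / abs_sin_prod (\<alpha> :: real ^ 'n)"
  by (simp add: abs_sin_prod_def abs_prod prod_dividef)

lemma square_integrable_chirp:
  "square_integrable u \<Longrightarrow> square_integrable (\<lambda>x. u x * mfrft_chirp \<alpha> lam x)"
  by (rule square_integrable_bound[of u _ 1]) (auto simp: norm_mult square_integrable_def)

lemma integrable_chirp:
  fixes u :: "real ^ 'n \<Rightarrow> complex"
  assumes "integrable lebesgue u"
  shows "integrable lebesgue (\<lambda>x. u x * mfrft_chirp \<alpha> lam x)"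
proof -
  have [measurable]: "u \<in> borel_measurable lebesgue" using assms by auto
  show ?thesis by (rule Bochner_Integration.integrable_bound[OF assms]) (auto simp: norm_mult)
qed

lemma L2norm_chirp: "L2norm (\<lambda>x. u x * mfrft_chirp \<alpha> lam x) = L2norm u"
  by (simp add: L2norm_def norm_mult)

lemma abs_sin_prod_pos:
  "(\<And>k. sin (\<alpha> $ k) \<noteq> 0) \<Longrightarrow> 0 < abs_sin_prod \<alpha>"
  by (simp add: abs_sin_prod_def)

lemma dilated_fourier:
  fixes \<alpha> :: "real ^ 'n"
  assumes lam: "lam \<noteq> 0" and sin: "\<And>k. sin (\<alpha> $ k) \<noteq> 0"
    and q: "integrable lebesgue q" "square_integrable q"
  shows "square_integrable (\<lambda>\<xi>. fourier q (mfrft_freq \<alpha> lam \<xi>))"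
    and "(L2norm (\<lambda>\<xi>. fourier q (mfrft_freq \<alpha> lam \<xi>)))\<^sup>2
       = (2 * pi) ^ CARD('n) * abs_sin_prod \<alpha> / (lam\<^sup>2) ^ CARD('n) * (L2norm q)\<^sup>2"
proof -
  define d :: "real ^ 'n" where "d = (\<chi> k. lam\<^sup>2 / sin (\<alpha> $ k))"
  have d: "d $ k \<noteq> 0" for k using lam sin by (simp add: d_def)
  have e: "(\<chi> k. 0 $ k + d $ k * \<xi> $ k) = mfrft_freq \<alpha> lam \<xi>" for \<xi>
    by (simp add: d_def mfrft_freq_def)
  note P = plancherel[OF q]
  have [measurable]: "fourier q \<in> borel_measurable lebesgue" using P by auto
  have m: "(\<lambda>\<xi>. fourier q (mfrft_freq \<alpha> lam \<xi>)) \<in> borel_measurable lebesgue"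
    using measurable_compose[OF measurable_diag[of d 0, OF d] \<open>fourier q \<in> borel_measurable lebesgue\<close>]
    unfolding e .
  have h: "(\<lambda>\<eta>. (cmod (fourier q \<eta>))\<^sup>2) \<in> borel_measurable lebesgue" by measurable
  show "square_integrable (\<lambda>\<xi>. fourier q (mfrft_freq \<alpha> lam \<xi>))"
    using P(1) integrable_diag[of d "\<lambda>\<eta>. (cmod (fourier q \<eta>))\<^sup>2" 0, OF d h] m
    unfolding square_integrable_def e by simp
  have pd: "(\<Prod>k\<in>UNIV. \<bar>d $ k\<bar>) = (lam\<^sup>2) ^ CARD('n) / abs_sin_prod \<alpha>"
    using mfrft_freq_prod[of \<alpha> lam] sin by (simp add: d_def)
  have "(2 * pi) ^ CARD('n) * (L2norm q)\<^sup>2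
     = (lam\<^sup>2) ^ CARD('n) / abs_sin_prod \<alpha> * (L2norm (\<lambda>\<xi>. fourier q (mfrft_freq \<alpha> lam \<xi>)))\<^sup>2"
    using integral_diag[of d "\<lambda>\<eta>. (cmod (fourier q \<eta>))\<^sup>2" 0, OF d h] P(2)
    unfolding e pd L2norm_sq by simp
  then show "(L2norm (\<lambda>\<xi>. fourier q (mfrft_freq \<alpha> lam \<xi>)))\<^sup>2
       = (2 * pi) ^ CARD('n) * abs_sin_prod \<alpha> / (lam\<^sup>2) ^ CARD('n) * (L2norm q)\<^sup>2"
    using lam abs_sin_prod_pos[of \<alpha>] sin by (simp add: field_simps)
qed

lemma cmod_mfrft_integral:
  fixes \<alpha> :: "real ^ 'n"
  assumes sin: "\<And>k. sin (\<alpha> $ k) \<noteq> 0"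
  shows "(cmod (mfrft_integral \<alpha> lam u \<xi>))\<^sup>2
    = (cmod (fourier (\<lambda>x. u x * mfrft_chirp \<alpha> lam x) (mfrft_freq \<alpha> lam \<xi>)))\<^sup>2
      / ((2 * pi) ^ CARD('n) * abs_sin_prod \<alpha>)"
proof -
  have "(cmod (complex_of_real (sqrt (2 * pi) ^ CARD('n))))\<^sup>2 = (2 * pi) ^ CARD('n)"
  proof -
    have "(sqrt (2 * pi) ^ CARD('n))\<^sup>2 = ((sqrt (2 * pi))\<^sup>2) ^ CARD('n)"
      by (simp only: power_mult[symmetric] mult.commute)
    then show ?thesis by (simp only: norm_of_real power2_abs) simp
  qed
  then show ?thesis
    unfolding mfrft_integral_eq_fourier norm_mult power_mult_distrib norm_divide power_divide
      cmod_mfrft_c_sq[OF sin] cmod_chirp by (simp del: of_real_power)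
qed

lemma measurable_mfrft_integral:
  assumes "lam \<noteq> 0" "\<And>k. sin (\<alpha> $ k) \<noteq> 0" "integrable lebesgue u" "square_integrable u"
  shows "mfrft_integral \<alpha> lam u \<in> borel_measurable lebesgue"
proof -
  have [measurable]: "(\<lambda>\<xi>. fourier (\<lambda>x. u x * mfrft_chirp \<alpha> lam x) (mfrft_freq \<alpha> lam \<xi>)) \<in> borel_measurable lebesgue"
    by (rule square_integrable_measurable[OF dilated_fourier(1)])
       (use assms in \<open>auto intro: integrable_chirp square_integrable_chirp\<close>)
  show ?thesis unfolding mfrft_integral_eq_fourier[abs_def] by measurable
qed

text \<open>
  Plancherel's theorem for the fractional transform. The modulus of \<open>mfrft_c \<alpha>\<close> cancels exactly the sines in the
  Jacobian of \<open>mfrft_freq\<close>, and only the power of \<open>lam\<close> remains, because the kernel is not normalised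
  in \<open>lam\<close>.
\<close>

theorem mfrft_integral_isometry:
  fixes \<alpha> :: "real ^ 'n"
  assumes lam: "lam \<noteq> 0" and sin: "\<And>k. sin (\<alpha> $ k) \<noteq> 0"
    and u: "integrable lebesgue u" "square_integrable u"
  shows "square_integrable (mfrft_integral \<alpha> lam u)"
    and "L2norm u = \<bar>lam\<bar> ^ CARD('n) * L2norm (mfrft_integral \<alpha> lam u)"
proof -
  let ?p = "\<lambda>x. u x * mfrft_chirp \<alpha> lam x"
  note D = dilated_fourier[OF lam sin integrable_chirp[OF u(1)] square_integrable_chirp[OF u(2)], of \<alpha> lam]
  note pos = abs_sin_prod_pos[of \<alpha>, OF sin]
  show "square_integrable (mfrft_integral \<alpha> lam u)"
    using D(1) measurable_mfrft_integral[OF lam sin u] unfolding square_integrable_def cmod_mfrft_integral[OF sin]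
    by auto
  have "(L2norm (mfrft_integral \<alpha> lam u))\<^sup>2
     = (L2norm (\<lambda>\<xi>. fourier ?p (mfrft_freq \<alpha> lam \<xi>)))\<^sup>2 / ((2 * pi) ^ CARD('n) * abs_sin_prod \<alpha>)"
    unfolding L2norm_sq cmod_mfrft_integral[OF sin] by simp
  also have "\<dots> = (L2norm u)\<^sup>2 / (lam\<^sup>2) ^ CARD('n)"
    unfolding D(2) L2norm_chirp using pos by simp
  finally have "(L2norm u)\<^sup>2 = (lam\<^sup>2) ^ CARD('n) * (L2norm (mfrft_integral \<alpha> lam u))\<^sup>2"
    using lam by simp
  also have "(lam\<^sup>2) ^ CARD('n) = (\<bar>lam\<bar> ^ CARD('n))\<^sup>2"
  proof -
    have "(\<bar>lam\<bar>\<^sup>2) ^ CARD('n) = (\<bar>lam\<bar> ^ CARD('n))\<^sup>2"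
      by (simp only: power_mult[symmetric] mult.commute)
    then show ?thesis by simp
  qed
  finally have "(L2norm u)\<^sup>2 = (\<bar>lam\<bar> ^ CARD('n) * L2norm (mfrft_integral \<alpha> lam u))\<^sup>2"
    by (simp add: power_mult_distrib)
  then show "L2norm u = \<bar>lam\<bar> ^ CARD('n) * L2norm (mfrft_integral \<alpha> lam u)"
    by (rule power2_eq_imp_eq) (auto simp: L2norm_nonneg)
qed

lemma mfrft_integral_diff:
  fixes u v :: "real ^ 'n \<Rightarrow> complex"
  assumes "integrable lebesgue u" "integrable lebesgue v"
  shows "mfrft_integral \<alpha> lam (\<lambda>x. u x - v x) \<xi> = mfrft_integral \<alpha> lam u \<xi> - mfrft_integral \<alpha> lam v \<xi>"
proof -
  have c: "continuous_on UNIV (\<lambda>x. mfrft_kernel \<alpha> lam x \<xi>)"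
    unfolding mfrft_kernel_def mfrft_chirp_def by (intro continuous_intros)
  note km = borel_measurable_continuous_lebesgue[OF c]
  have bd: "cmod (mfrft_kernel \<alpha> lam x \<xi>) = cmod (mfrft_c \<alpha> / of_real (sqrt (2 * pi) ^ CARD('n)))" for x
    unfolding mfrft_kernel_def norm_mult cmod_chirp by simp
  have "integrable lebesgue (\<lambda>x. w x * mfrft_kernel \<alpha> lam x \<xi>)" if w: "integrable lebesgue w" for w
  proof -
    have [measurable]: "w \<in> borel_measurable lebesgue" using w by auto
    note [measurable] = km
    have "integrable lebesgue (\<lambda>x. w x * (mfrft_c \<alpha> / of_real (sqrt (2 * pi) ^ CARD('n))))"
      using w by simp
    then show ?thesis
      by (rule Bochner_Integration.integrable_bound) (simp_all add: norm_mult norm_divide bd)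
  qed
  then show ?thesis
    using assms by (simp add: mfrft_integral_def left_diff_distrib)
qed

text \<open>
  The isometry carries the Cauchy sequence of truncations of \<open>f\<close> to a Cauchy sequence, whose limit
  works for every other approximating sequence. So the choice in the definition of \<open>mfrft\<close> is not
  over an empty set.
\<close>

theorem mfrft_exists:
  fixes \<alpha> :: "real ^ 'n"
  assumes lam: "lam \<noteq> 0" and sin: "\<And>k. sin (\<alpha> $ k) \<noteq> 0" and f: "square_integrable f"
  shows "\<exists>g. square_integrable g \<and>
    (\<forall>u. (\<forall>n. integrable lebesgue (u n)) \<longrightarrow> L2_tendsto u f \<longrightarrow> L2_tendsto (\<lambda>n. mfrft_integral \<alpha> lam (u n)) g)"
proof -
  define K where "K = \<bar>lam\<bar> ^ CARD('n)"
  have K: "K > 0" using lam by (simp add: K_def)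
  let ?T = "mfrft_integral \<alpha> lam"
  note iso = mfrft_integral_isometry[OF lam sin, folded K_def]
  have Td: "K * L2norm (\<lambda>\<xi>. ?T u \<xi> - ?T v \<xi>) \<le> L2norm (\<lambda>x. u x - f x) + L2norm (\<lambda>x. v x - f x)"
    if "integrable lebesgue u" "square_integrable u" "integrable lebesgue v" "square_integrable v" for u v
  proof -
    have "K * L2norm (\<lambda>\<xi>. ?T u \<xi> - ?T v \<xi>) = L2norm (\<lambda>x. u x - v x)"
      using iso(2)[of "\<lambda>x. u x - v x"] that
      by (simp add: square_integrable_diff mfrft_integral_diff[OF that(1,3), abs_def])
    also have "\<dots> \<le> L2norm (\<lambda>x. u x - f x) + L2norm (\<lambda>x. f x - v x)"
      by (rule L2norm_triangle3[OF that(2) f that(4)])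
    finally show ?thesis by (metis L2norm_minus_commute)
  qed
  define v where "v = truncate f"
  have vi: "integrable lebesgue (v n)" and v2: "square_integrable (v n)" for n
    unfolding v_def using f by (auto intro: integrable_truncate square_integrable_truncate)
  have vlim: "(\<lambda>n. L2norm (\<lambda>x. v n x - f x)) \<longlonglongrightarrow> 0"
    using L2_tendsto_truncate[OF f] by (simp add: L2_tendsto_def v_def)
  have "\<exists>g. L2_tendsto (\<lambda>n. ?T (v n)) g"
  proof (rule L2_complete)
    show "square_integrable (?T (v n))" for n by (rule iso(1)[OF vi v2])
    fix e :: real assume e: "0 < e"
    then have "0 < K * e / 2" using K by simp
    from order_tendstoD(2)[OF vlim this] obtain N where
      N: "\<And>n. N \<le> n \<Longrightarrow> L2norm (\<lambda>x. v n x - f x) < K * e / 2" by (auto simp: eventually_sequentially)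
    have "L2norm (\<lambda>\<xi>. ?T (v m) \<xi> - ?T (v n) \<xi>) \<le> e" if "N \<le> m" "N \<le> n" for m n
    proof -
      have "K * L2norm (\<lambda>\<xi>. ?T (v m) \<xi> - ?T (v n) \<xi>) \<le> K * e"
        using Td[OF vi[of m] v2[of m] vi[of n] v2[of n]] N[OF that(1)] N[OF that(2)] by linarith
      then show ?thesis using K by simp
    qed
    then show "\<exists>N. \<forall>m\<ge>N. \<forall>n\<ge>N. L2norm (\<lambda>\<xi>. ?T (v m) \<xi> - ?T (v n) \<xi>) \<le> e" by blast
  qed
  then obtain g where g: "L2_tendsto (\<lambda>n. ?T (v n)) g" by blast
  have g2: "square_integrable g" using g by (simp add: L2_tendsto_def)
  have "L2_tendsto (\<lambda>n. ?T (u n)) g" if ui: "\<forall>n. integrable lebesgue (u n)" and uf: "L2_tendsto u f" for u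
  proof -
    have u2: "square_integrable (u n)" for n using uf by (simp add: L2_tendsto_def)
    have T2: "square_integrable (?T (u n))" "square_integrable (?T (v n))" for n
      using iso(1) ui u2 vi v2 by auto
    have "L2norm (\<lambda>\<xi>. ?T (u n) \<xi> - g \<xi>)
      \<le> (L2norm (\<lambda>x. u n x - f x) + L2norm (\<lambda>x. v n x - f x)) / K + L2norm (\<lambda>\<xi>. ?T (v n) \<xi> - g \<xi>)" for n
    proof -
      have "L2norm (\<lambda>\<xi>. ?T (u n) \<xi> - ?T (v n) \<xi>)
        \<le> (L2norm (\<lambda>x. u n x - f x) + L2norm (\<lambda>x. v n x - f x)) / K"
        using Td[of "u n" "v n"] ui u2 vi v2 K by (simp add: pos_le_divide_eq mult.commute)
      then show ?thesis using L2norm_triangle3[OF T2(1)[of n] T2(2)[of n] g2] by linarith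
    qed
    moreover have "(\<lambda>n. (L2norm (\<lambda>x. u n x - f x) + L2norm (\<lambda>x. v n x - f x)) / K + L2norm (\<lambda>\<xi>. ?T (v n) \<xi> - g \<xi>))
        \<longlonglongrightarrow> (0 + 0) / K + 0"
      using uf g K by (intro tendsto_intros vlim) (auto simp: L2_tendsto_def)
    ultimately have "(\<lambda>n. L2norm (\<lambda>\<xi>. ?T (u n) \<xi> - g \<xi>)) \<longlonglongrightarrow> 0"
      by (intro Lim_null_comparison[OF always_eventually, of "\<lambda>n. L2norm (\<lambda>\<xi>. ?T (u n) \<xi> - g \<xi>)"
         "\<lambda>n. (L2norm (\<lambda>x. u n x - f x) + L2norm (\<lambda>x. v n x - f x)) / K + L2norm (\<lambda>\<xi>. ?T (v n) \<xi> - g \<xi>)"])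
        (simp_all add: L2norm_nonneg)
    then show ?thesis using T2(1) g2 by (simp add: L2_tendsto_def)
  qed
  with g2 show ?thesis by blast
qed

section \<open>Translations and the fractional transform\<close>

lemma mfrft_L2:
  assumes "lam \<noteq> 0" "\<And>k. sin (\<alpha> $ k) \<noteq> 0" "square_integrable f"
  shows square_integrable_mfrft: "square_integrable (mfrft \<alpha> lam f)"
    and mfrft_tendsto: "(\<And>n. integrable lebesgue (u n)) \<Longrightarrow> L2_tendsto u f
        \<Longrightarrow> L2_tendsto (\<lambda>n. mfrft_integral \<alpha> lam (u n)) (mfrft \<alpha> lam f)"
  using someI_ex[OF mfrft_exists[OF assms]] unfolding mfrft_def by blast+

text \<open>
  This replaces the rule that differentiation becomes multiplication by the frequency, and needs no
  weak derivatives.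
\<close>

lemma fourier_shift_diff:
  fixes p :: "real ^ 'n \<Rightarrow> complex"
  assumes p: "integrable lebesgue p"
  shows "fourier (\<lambda>x. p (x + z) - p x) \<eta> = (cis (z \<bullet> \<eta>) - 1) * fourier p \<eta>"
proof -
  have [measurable]: "(\<lambda>x. cis (- (x \<bullet> \<eta>))) \<in> borel_measurable lebesgue"
    by (intro measurable_completion) simp
  have pm[measurable]: "p \<in> borel_measurable lebesgue" using p by auto
  have int: "integrable lebesgue (\<lambda>x. p x * cis (- (x \<bullet> \<eta>)))"
    by (rule Bochner_Integration.integrable_bound[OF p]) (auto simp: norm_mult)
  have m: "(\<lambda>x. p x * cis (- (x \<bullet> \<eta>))) \<in> borel_measurable lebesgue" by measurable
  have eq: "p (x + z) * cis (- (x \<bullet> \<eta>)) = cis (z \<bullet> \<eta>) * (p (x + z) * cis (- ((x + z) \<bullet> \<eta>)))" for x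
  proof -
    have "cis (z \<bullet> \<eta>) * cis (- ((x + z) \<bullet> \<eta>)) = cis (- (x \<bullet> \<eta>))"
      by (simp add: cis_mult inner_add_left)
    then show ?thesis by (metis mult.left_commute)
  qed
  have ints: "integrable lebesgue (\<lambda>x. p (x + z) * cis (- (x \<bullet> \<eta>)))"
    unfolding eq using int integrable_shift[OF m, of z] by simp
  have "(LINT x|lebesgue. p (x + z) * cis (- (x \<bullet> \<eta>))) = cis (z \<bullet> \<eta>) * fourier p \<eta>"
    unfolding eq fourier_def using integral_shift[OF m, of z] by simp
  then show ?thesis
    unfolding fourier_def[of "\<lambda>x. p (x + z) - p x"] using int ints
    by (simp add: left_diff_distrib fourier_def)
qed

text \<open>
  The chirp has to be absorbed into the function before translating, because a translate of \<open>u\<close> itself is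
  in general transformed into a translate in frequency as well.
\<close>

lemma L2norm_shift_diff_integral:
  fixes \<alpha> :: "real ^ 'n" and u :: "real ^ 'n \<Rightarrow> complex"
  assumes lam: "lam \<noteq> 0" and sin: "\<And>k. sin (\<alpha> $ k) \<noteq> 0"
    and u: "integrable lebesgue u" "square_integrable u"
  defines "p \<equiv> \<lambda>x. u x * mfrft_chirp \<alpha> lam x"
  shows "L2norm (\<lambda>x. p (x + z) - p x)
    = \<bar>lam\<bar> ^ CARD('n) * L2norm (\<lambda>\<xi>. (cis (z \<bullet> mfrft_freq \<alpha> lam \<xi>) - 1) * mfrft_integral \<alpha> lam u \<xi>)"
proof -
  define q where "q = (\<lambda>x. p (x + z) - p x)"
  have p: "integrable lebesgue p" "square_integrable p"
    unfolding p_def using u by (auto intro: integrable_chirp square_integrable_chirp)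
  have q2: "square_integrable q" unfolding q_def by (intro square_integrable_diff square_integrable_shift p)
  have qi: "integrable lebesgue q"
    unfolding q_def using p(1) by (simp add: integrable_shift[OF borel_measurable_integrable[OF p(1)]])
  note pos = abs_sin_prod_pos[of \<alpha>, OF sin]
  have "(cmod ((cis (z \<bullet> mfrft_freq \<alpha> lam \<xi>) - 1) * mfrft_integral \<alpha> lam u \<xi>))\<^sup>2
      = (cmod (fourier q (mfrft_freq \<alpha> lam \<xi>)))\<^sup>2 / ((2 * pi) ^ CARD('n) * abs_sin_prod \<alpha>)" for \<xi>
    unfolding q_def fourier_shift_diff[OF p(1)] norm_mult power_mult_distrib cmod_mfrft_integral[OF sin]
    by (simp add: p_def)
  then have "(L2norm (\<lambda>\<xi>. (cis (z \<bullet> mfrft_freq \<alpha> lam \<xi>) - 1) * mfrft_integral \<alpha> lam u \<xi>))\<^sup>2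
     = (L2norm (\<lambda>\<xi>. fourier q (mfrft_freq \<alpha> lam \<xi>)))\<^sup>2 / ((2 * pi) ^ CARD('n) * abs_sin_prod \<alpha>)"
    unfolding L2norm_sq by simp
  also have "\<dots> = (L2norm q)\<^sup>2 / (lam\<^sup>2) ^ CARD('n)"
    unfolding dilated_fourier(2)[OF lam sin qi q2] using pos by simp
  finally have "(L2norm q)\<^sup>2 = (lam\<^sup>2) ^ CARD('n)
      * (L2norm (\<lambda>\<xi>. (cis (z \<bullet> mfrft_freq \<alpha> lam \<xi>) - 1) * mfrft_integral \<alpha> lam u \<xi>))\<^sup>2"
    using lam by simp
  also have "(lam\<^sup>2) ^ CARD('n) = (\<bar>lam\<bar> ^ CARD('n))\<^sup>2"
  proof -
    have "(\<bar>lam\<bar>\<^sup>2) ^ CARD('n) = (\<bar>lam\<bar> ^ CARD('n))\<^sup>2"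
      by (simp only: power_mult[symmetric] mult.commute)
    then show ?thesis by simp
  qed
  finally have "(L2norm q)\<^sup>2 = (\<bar>lam\<bar> ^ CARD('n)
      * L2norm (\<lambda>\<xi>. (cis (z \<bullet> mfrft_freq \<alpha> lam \<xi>) - 1) * mfrft_integral \<alpha> lam u \<xi>))\<^sup>2"
    by (simp only: power_mult_distrib)
  then show ?thesis
    unfolding q_def[symmetric] by (rule power2_eq_imp_eq) (auto simp: L2norm_nonneg)
qed

lemma measurable_shift_multiplier:
  "(\<lambda>\<xi>. cis (z \<bullet> mfrft_freq \<alpha> lam \<xi>) - 1) \<in> borel_measurable lebesgue"
  unfolding mfrft_freq_def inner_vec_def cis_conv_exp
  by (intro borel_measurable_continuous_lebesgue continuous_intros)

lemma square_integrable_multiplier: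
  assumes "square_integrable g"
  shows "square_integrable (\<lambda>\<xi>. (cis (z \<bullet> mfrft_freq \<alpha> lam \<xi>) - 1) * g \<xi>)"
    and "L2norm (\<lambda>\<xi>. (cis (z \<bullet> mfrft_freq \<alpha> lam \<xi>) - 1) * g \<xi>) \<le> 2 * L2norm g"
proof -
  note [measurable] = assms measurable_shift_multiplier
  have le: "cmod (cis (z \<bullet> mfrft_freq \<alpha> lam \<xi>) - 1) \<le> 2" for \<xi>
    using norm_triangle_ineq4[of "cis (z \<bullet> mfrft_freq \<alpha> lam \<xi>)" 1] by simp
  show sq: "square_integrable (\<lambda>\<xi>. (cis (z \<bullet> mfrft_freq \<alpha> lam \<xi>) - 1) * g \<xi>)"
    by (rule square_integrable_bound[OF assms, of _ 2]) (auto simp: norm_mult intro!: mult_right_mono le)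
  have "L2norm (\<lambda>\<xi>. (cis (z \<bullet> mfrft_freq \<alpha> lam \<xi>) - 1) * g \<xi>) \<le> L2norm (\<lambda>\<xi>. 2 * g \<xi>)"
    by (intro L2norm_mono sq square_integrable_cmult assms) (auto simp: norm_mult intro!: mult_right_mono le)
  then show "L2norm (\<lambda>\<xi>. (cis (z \<bullet> mfrft_freq \<alpha> lam \<xi>) - 1) * g \<xi>) \<le> 2 * L2norm g"
    by (simp add: L2norm_cmult)
qed

lemma mfrft_passage_to_limit:
  fixes \<alpha> :: "real ^ 'n" and f :: "real ^ 'n \<Rightarrow> complex"
  assumes lam: "lam \<noteq> 0" and sin: "\<And>k. sin (\<alpha> $ k) \<noteq> 0" and f: "square_integrable f"
  shows "(\<lambda>n. L2norm (\<lambda>x. truncate f n x - f x)) \<longlonglongrightarrow> 0"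
    and "(\<lambda>n. L2norm (\<lambda>\<xi>. mfrft_integral \<alpha> lam (truncate f n) \<xi> - mfrft \<alpha> lam f \<xi>)) \<longlonglongrightarrow> 0"
  using L2_tendsto_truncate[OF f] mfrft_tendsto[OF lam sin f integrable_truncate[OF f] L2_tendsto_truncate[OF f]]
  by (simp_all add: L2_tendsto_def)

text \<open>
  This settles the degenerate case of the inequality: if the transform vanishes almost everywhere,
  then so does \<open>f\<close>.
\<close>

lemma L2norm_le_mfrft:
  fixes \<alpha> :: "real ^ 'n" and f :: "real ^ 'n \<Rightarrow> complex"
  assumes lam: "lam \<noteq> 0" and sin: "\<And>k. sin (\<alpha> $ k) \<noteq> 0" and f: "square_integrable f"
  shows "L2norm f \<le> \<bar>lam\<bar> ^ CARD('n) * L2norm (mfrft \<alpha> lam f)"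
proof -
  let ?K = "\<bar>lam\<bar> ^ CARD('n)" and ?g = "mfrft \<alpha> lam f"
  let ?u = "truncate f" and ?T = "mfrft_integral \<alpha> lam"
  note lims = mfrft_passage_to_limit[OF lam sin f]
  note g = square_integrable_mfrft[OF lam sin f]
  have "L2norm f \<le> L2norm (\<lambda>x. ?u n x - f x) + ?K * (L2norm (\<lambda>\<xi>. ?T (?u n) \<xi> - ?g \<xi>) + L2norm ?g)" for n
  proof -
    note u = integrable_truncate[OF f, of n] square_integrable_truncate[OF f, of n]
    note T = mfrft_integral_isometry[OF lam sin u]
    have "L2norm f \<le> L2norm (\<lambda>x. f x - ?u n x) + L2norm (?u n)"
      using L2norm_triangle[OF square_integrable_diff[OF f u(2)] u(2)] by simp
    moreover have "L2norm (?T (?u n)) \<le> L2norm (\<lambda>\<xi>. ?T (?u n) \<xi> - ?g \<xi>) + L2norm ?g"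
      using L2norm_triangle[OF square_integrable_diff[OF T(1) g] g] by simp
    then have "L2norm (?u n) \<le> ?K * (L2norm (\<lambda>\<xi>. ?T (?u n) \<xi> - ?g \<xi>) + L2norm ?g)"
      unfolding T(2) by (intro mult_left_mono) auto
    ultimately show ?thesis by (simp add: L2norm_minus_commute[of f])
  qed
  moreover have "(\<lambda>n. L2norm (\<lambda>x. ?u n x - f x) + ?K * (L2norm (\<lambda>\<xi>. ?T (?u n) \<xi> - ?g \<xi>) + L2norm ?g))
      \<longlonglongrightarrow> 0 + ?K * (0 + L2norm ?g)"
    by (intro tendsto_intros lims)
  ultimately show ?thesis by (auto intro: LIMSEQ_le_const)
qed

text \<open>
  Both sides of the identity for integrable functions are continuous in the \<open>L\<^sup>2\<close> norm: the translation is
  isometric and the multiplier is bounded by \<open>2\<close>. Hence it survives the limit along the truncations of \<open>f\<close>.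
\<close>

lemma L2norm_shift_diff_le_mfrft:
  fixes \<alpha> :: "real ^ 'n" and f :: "real ^ 'n \<Rightarrow> complex"
  assumes lam: "lam \<noteq> 0" and sin: "\<And>k. sin (\<alpha> $ k) \<noteq> 0" and f: "square_integrable f"
  defines "p \<equiv> \<lambda>x. f x * mfrft_chirp \<alpha> lam x"
  shows "L2norm (\<lambda>x. p (x + z) - p x)
    \<le> \<bar>lam\<bar> ^ CARD('n) * L2norm (\<lambda>\<xi>. (cis (z \<bullet> mfrft_freq \<alpha> lam \<xi>) - 1) * mfrft \<alpha> lam f \<xi>)"
proof -
  let ?K = "\<bar>lam\<bar> ^ CARD('n)" and ?g = "mfrft \<alpha> lam f"
  let ?u = "truncate f" and ?T = "mfrft_integral \<alpha> lam"
  let ?m = "\<lambda>\<xi>. cis (z \<bullet> mfrft_freq \<alpha> lam \<xi>) - 1"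
  let ?P = "\<lambda>u x. u x * mfrft_chirp \<alpha> lam x"
  note lims = mfrft_passage_to_limit[OF lam sin f]
  note g = square_integrable_mfrft[OF lam sin f]
  have p: "square_integrable p" unfolding p_def by (rule square_integrable_chirp[OF f])
  have "L2norm (\<lambda>x. p (x + z) - p x)
     \<le> 2 * L2norm (\<lambda>x. ?u n x - f x) + ?K * (2 * L2norm (\<lambda>\<xi>. ?T (?u n) \<xi> - ?g \<xi>) + L2norm (\<lambda>\<xi>. ?m \<xi> * ?g \<xi>))" for n
  proof -
    note u = integrable_truncate[OF f, of n] square_integrable_truncate[OF f, of n]
    note T = mfrft_integral_isometry(1)[OF lam sin u]
    define r where "r = ?P (?u n)"
    have r: "square_integrable r" unfolding r_def by (rule square_integrable_chirp[OF u(2)])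
    have pr: "square_integrable (\<lambda>x. p x - r x)" by (intro square_integrable_diff p r)
    have prn: "L2norm (\<lambda>x. p x - r x) = L2norm (\<lambda>x. ?u n x - f x)"
    proof -
      have "(\<lambda>x. p x - r x) = ?P (\<lambda>x. f x - ?u n x)" by (simp add: p_def r_def left_diff_distrib)
      then show ?thesis by (metis L2norm_chirp L2norm_minus_commute)
    qed
    note sh = square_integrable_shift[of _ z]
    have q1: "square_integrable (\<lambda>x. r (x + z) - r x)" by (intro square_integrable_diff sh r)
    have q2: "square_integrable (\<lambda>x. (p (x + z) - r (x + z)) - (p x - r x))"
      by (intro square_integrable_diff sh p r)
    have "L2norm (\<lambda>x. p (x + z) - p x) \<le> L2norm (\<lambda>x. r (x + z) - r x) + L2norm (\<lambda>x. (p (x + z) - r (x + z)) - (p x - r x))"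
      using L2norm_triangle[OF q1 q2] by (simp add: algebra_simps)
    also have "L2norm (\<lambda>x. (p (x + z) - r (x + z)) - (p x - r x)) \<le> 2 * L2norm (\<lambda>x. ?u n x - f x)"
      using L2norm_triangle_diff[OF sh[OF pr] pr] L2norm_shift[OF pr, of z] prn by simp
    also have "L2norm (\<lambda>x. r (x + z) - r x) = ?K * L2norm (\<lambda>\<xi>. ?m \<xi> * ?T (?u n) \<xi>)"
      unfolding r_def by (rule L2norm_shift_diff_integral[OF lam sin u])
    also have "L2norm (\<lambda>\<xi>. ?m \<xi> * ?T (?u n) \<xi>) \<le> 2 * L2norm (\<lambda>\<xi>. ?T (?u n) \<xi> - ?g \<xi>) + L2norm (\<lambda>\<xi>. ?m \<xi> * ?g \<xi>)"
    proof -
      have "L2norm (\<lambda>\<xi>. ?m \<xi> * ?T (?u n) \<xi>)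
         \<le> L2norm (\<lambda>\<xi>. ?m \<xi> * (?T (?u n) \<xi> - ?g \<xi>)) + L2norm (\<lambda>\<xi>. ?m \<xi> * ?g \<xi>)"
        using L2norm_triangle[OF square_integrable_multiplier(1)[OF square_integrable_diff[OF T g]]
            square_integrable_multiplier(1)[OF g], of z \<alpha> lam z \<alpha> lam]
        by (simp add: algebra_simps)
      also have "L2norm (\<lambda>\<xi>. ?m \<xi> * (?T (?u n) \<xi> - ?g \<xi>)) \<le> 2 * L2norm (\<lambda>\<xi>. ?T (?u n) \<xi> - ?g \<xi>)"
        by (rule square_integrable_multiplier(2)[OF square_integrable_diff[OF T g]])
      finally show ?thesis by simp
    qed
    finally show ?thesis by (simp add: mult_left_mono add.commute)
  qed
  moreover have "(\<lambda>n. 2 * L2norm (\<lambda>x. ?u n x - f x) + ?K * (2 * L2norm (\<lambda>\<xi>. ?T (?u n) \<xi> - ?g \<xi>) + L2norm (\<lambda>\<xi>. ?m \<xi> * ?g \<xi>)))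
     \<longlonglongrightarrow> 2 * 0 + ?K * (2 * 0 + L2norm (\<lambda>\<xi>. ?m \<xi> * ?g \<xi>))"
    by (intro tendsto_intros lims)
  ultimately show ?thesis by (auto intro: LIMSEQ_le_const)
qed

lemma cmod_cis_minus_one_le: "cmod (cis t - 1) \<le> \<bar>t\<bar>"
proof -
  have "(cmod (cis t - 1))\<^sup>2 = 2 - 2 * cos t"
    by (simp add: cmod_power2 power2_diff sin_squared_eq)
  also have "\<dots> = (2 * sin (t/2))\<^sup>2"
    using cos_double_sin[of "t/2"] by (simp add: power_mult_distrib)
  also have "\<dots> \<le> t\<^sup>2"
    using abs_sin_le_one abs_sin_x_le_abs_x[of "t/2"] by (intro abs_le_square_iff[THEN iffD1]) (simp add: abs_mult)
  finally show ?thesis by (simp add: abs_le_square_iff[symmetric])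
qed

section \<open>The uncertainty inequality\<close>

text \<open>
  The classical proof integrates \<open>x $ k\<close> against the derivative of \<open>|p|\<^sup>2\<close> by parts. With a step \<open>h\<close> instead of a
  derivative, integration by parts becomes the substitution \<open>x \<mapsto> x + axis k h\<close>, which gives
  \<open>h (L2norm p)\<^sup>2 = \<integral> x $ k (|p x|\<^sup>2 - |p (x + axis k h)|\<^sup>2)\<close>. The right hand side is at most
  the norm of the difference times the norms of \<open>x $ k p\<close> for \<open>p\<close> and for its translate. Divide by \<open>h\<close> and let \<open>h\<close>
  tend to \<open>0\<close>.
\<close>

theorem uncertainty_finite_difference:
  fixes p :: "real ^ 'n \<Rightarrow> complex"
  assumes p: "square_integrable p" and xp: "square_integrable (\<lambda>x. of_real (x $ k) * p x)"
    and B: "\<And>h. 0 < h \<Longrightarrow> L2norm (\<lambda>x. p (x + axis k h) - p x) \<le> h * B"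
  shows "(L2norm p)\<^sup>2 \<le> 2 * B * L2norm (\<lambda>x. of_real (x $ k) * p x)"
proof -
  let ?a = "L2norm (\<lambda>x. of_real (x $ k) * p x)"
  have step: "(L2norm p)\<^sup>2 \<le> B * (2 * ?a + h * L2norm p)" if h: "0 < h" for h
  proof -
    let ?ps = "\<lambda>x. p (x + axis k h)"
    define q where "q = (\<lambda>x. ?ps x - p x)"
    have ps: "square_integrable ?ps" by (rule square_integrable_shift[OF p])
    have q: "square_integrable q" unfolding q_def by (intro square_integrable_diff ps p)
    define yp where "yp = (\<lambda>x. of_real (x $ k - h) * p x)"
    have yp: "square_integrable yp"
      using square_integrable_diff[OF xp square_integrable_cmult[OF p, of "of_real h"]]
      by (simp add: yp_def left_diff_distrib)
    have ypn: "L2norm yp \<le> ?a + h * L2norm p"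
      using L2norm_triangle[OF xp square_integrable_cmult[OF p, of "- of_real h"]] h
        L2norm_cmult[of "- of_real h" p]
      by (simp add: yp_def left_diff_distrib)
    have xps: "(\<lambda>x. of_real (x $ k) * ?ps x) = (\<lambda>x. yp (x + axis k h))"
      by (simp add: yp_def axis_def)
    have xps2: "square_integrable (\<lambda>x. of_real (x $ k) * ?ps x)"
      and xpsn: "L2norm (\<lambda>x. of_real (x $ k) * ?ps x) = L2norm yp"
      unfolding xps using square_integrable_shift[OF yp] L2norm_shift[OF yp] by auto
    note [measurable] = p[THEN square_integrable_measurable]
    have km[measurable]: "(\<lambda>x::real^'n. x $ k) \<in> borel_measurable lebesgue"
      by (intro borel_measurable_continuous_lebesgue continuous_intros)
    have i1: "integrable lebesgue (\<lambda>x. x $ k * (cmod (p x))\<^sup>2)"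
      by (rule Bochner_Integration.integrable_bound[OF integrable_mult_square_integrable[OF xp p]])
         (auto simp: norm_mult abs_mult power2_eq_square)
    have i0: "integrable lebesgue (\<lambda>x. (cmod (p x))\<^sup>2)" using p by (simp add: square_integrable_def)
    have i2: "integrable lebesgue (\<lambda>x. (x $ k - h) * (cmod (p x))\<^sup>2)"
      using i1 i0 by (simp add: left_diff_distrib)
    have m2: "(\<lambda>x. (x $ k - h) * (cmod (p x))\<^sup>2) \<in> borel_measurable lebesgue" by measurable
    have e3: "((x + axis k h) $ k - h) * (cmod (p (x + axis k h)))\<^sup>2 = x $ k * (cmod (?ps x))\<^sup>2" for x
      by (simp add: axis_def)
    have i3: "integrable lebesgue (\<lambda>x. x $ k * (cmod (?ps x))\<^sup>2)"
      using i2 integrable_shift[OF m2, of "axis k h"] unfolding e3 by simp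
    have "(LINT x|lebesgue. x $ k * (cmod (?ps x))\<^sup>2) = (LINT x|lebesgue. (x $ k - h) * (cmod (p x))\<^sup>2)"
      using integral_shift[OF m2, of "axis k h"] unfolding e3 .
    also have "\<dots> = (LINT x|lebesgue. x $ k * (cmod (p x))\<^sup>2) - h * (L2norm p)\<^sup>2"
      unfolding L2norm_sq using i1 i0 by (simp add: left_diff_distrib)
    finally have "h * (L2norm p)\<^sup>2 = (LINT x|lebesgue. x $ k * (cmod (p x))\<^sup>2 - x $ k * (cmod (?ps x))\<^sup>2)"
      using i1 i3 by simp
    also have "\<dots> \<le> (LINT x|lebesgue. cmod (q x) * cmod (of_real (x $ k) * p x) + cmod (q x) * cmod (of_real (x $ k) * ?ps x))"
    proof (rule integral_mono)
      fix x
      have "(cmod (p x))\<^sup>2 - (cmod (?ps x))\<^sup>2 = (cmod (p x) - cmod (?ps x)) * (cmod (p x) + cmod (?ps x))"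
        by (simp add: power2_eq_square algebra_simps)
      then have "\<bar>(cmod (p x))\<^sup>2 - (cmod (?ps x))\<^sup>2\<bar> \<le> cmod (q x) * (cmod (p x) + cmod (?ps x))"
        using norm_triangle_ineq3[of "?ps x" "p x"]
        by (auto simp: abs_mult q_def intro!: mult_right_mono)
      then have "\<bar>x $ k\<bar> * \<bar>(cmod (p x))\<^sup>2 - (cmod (?ps x))\<^sup>2\<bar> \<le> \<bar>x $ k\<bar> * (cmod (q x) * (cmod (p x) + cmod (?ps x)))"
        by (intro mult_left_mono) auto
      moreover have "x $ k * (cmod (p x))\<^sup>2 - x $ k * (cmod (?ps x))\<^sup>2 \<le> \<bar>x $ k\<bar> * \<bar>(cmod (p x))\<^sup>2 - (cmod (?ps x))\<^sup>2\<bar>"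
        by (simp add: abs_mult[symmetric] right_diff_distrib)
      ultimately show "x $ k * (cmod (p x))\<^sup>2 - x $ k * (cmod (?ps x))\<^sup>2
          \<le> cmod (q x) * cmod (of_real (x $ k) * p x) + cmod (q x) * cmod (of_real (x $ k) * ?ps x)"
        by (simp add: norm_mult algebra_simps)
    qed (use i1 i3 integrable_mult_square_integrable[OF q xp] integrable_mult_square_integrable[OF q xps2] in auto)
    also have "\<dots> = (LINT x|lebesgue. cmod (q x) * cmod (of_real (x $ k) * p x)) + (LINT x|lebesgue. cmod (q x) * cmod (of_real (x $ k) * ?ps x))"
      using integrable_mult_square_integrable[OF q xp] integrable_mult_square_integrable[OF q xps2]
      by (rule Bochner_Integration.integral_add)
    also have "\<dots> \<le> L2norm q * ?a + L2norm q * L2norm yp"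
      using L2norm_Cauchy_Schwarz[OF q xp] L2norm_Cauchy_Schwarz[OF q xps2] unfolding xpsn by linarith
    also have "\<dots> = L2norm q * (?a + L2norm yp)" by (simp add: distrib_left)
    also have "\<dots> \<le> (h * B) * (2 * ?a + h * L2norm p)"
      using B[OF h] ypn by (intro mult_mono) (auto simp: q_def L2norm_nonneg order_trans[OF L2norm_nonneg])
    finally have "h * (L2norm p)\<^sup>2 \<le> h * (B * (2 * ?a + h * L2norm p))" by (simp add: mult_ac)
    then show ?thesis using h by simp
  qed
  have "((\<lambda>h. B * (2 * ?a + h * L2norm p)) \<longlongrightarrow> B * (2 * ?a + 0 * L2norm p)) (at_right 0)"
    by (intro tendsto_intros)
  then have "(L2norm p)\<^sup>2 \<le> B * (2 * ?a + 0 * L2norm p)"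
    by (rule tendsto_lowerbound) (auto simp: eventually_at_right_less intro!: eventually_mono[OF eventually_at_right_less] step)
  then show ?thesis by (simp add: mult_ac)
qed

text \<open>
  The bound \<open>|cis t - 1| \<le> |t|\<close> makes the coordinate \<open>\<xi> $ k\<close>, scaled by \<open>lam\<^sup>2 / sin (\<alpha> $ k)\<close>, an upper bound for the
  difference quotients of the chirped function, uniformly in the step.
\<close>

theorem mfrft_coordinate_uncertainty:
  fixes \<alpha> :: "real ^ 'n" and f :: "real ^ 'n \<Rightarrow> complex"
  assumes lam: "lam \<noteq> 0" and sin: "\<And>k. sin (\<alpha> $ k) \<noteq> 0" and f: "square_integrable f"
    and xf: "square_integrable (\<lambda>x. of_real (x $ k) * f x)"
    and xg: "square_integrable (\<lambda>\<xi>. of_real (\<xi> $ k) * mfrft \<alpha> lam f \<xi>)"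
  shows "(L2norm f)\<^sup>2 \<le> 2 * (\<bar>lam\<bar> ^ CARD('n) * lam\<^sup>2 / \<bar>sin (\<alpha> $ k)\<bar>)
      * L2norm (\<lambda>\<xi>. of_real (\<xi> $ k) * mfrft \<alpha> lam f \<xi>) * L2norm (\<lambda>x. of_real (x $ k) * f x)"
proof -
  define p where "p = (\<lambda>x. f x * mfrft_chirp \<alpha> lam x)"
  let ?K = "\<bar>lam\<bar> ^ CARD('n)" and ?g = "mfrft \<alpha> lam f"
  let ?b = "L2norm (\<lambda>\<xi>. of_real (\<xi> $ k) * ?g \<xi>)"
  have e: "(\<lambda>x. of_real (x $ k) * p x) = (\<lambda>x. (of_real (x $ k) * f x) * mfrft_chirp \<alpha> lam x)"
    by (simp add: p_def mult.assoc)
  have "(L2norm p)\<^sup>2 \<le> 2 * (?K * lam\<^sup>2 / \<bar>sin (\<alpha> $ k)\<bar> * ?b) * L2norm (\<lambda>x. of_real (x $ k) * p x)"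
  proof (rule uncertainty_finite_difference)
    show "square_integrable p" unfolding p_def by (rule square_integrable_chirp[OF f])
    show "square_integrable (\<lambda>x. of_real (x $ k) * p x)" unfolding e by (rule square_integrable_chirp[OF xf])
    fix h :: real assume h: "0 < h"
    let ?m = "\<lambda>\<xi>. cis (axis k h \<bullet> mfrft_freq \<alpha> lam \<xi>) - 1"
    let ?c = "h * (lam\<^sup>2 / \<bar>sin (\<alpha> $ k)\<bar>)"
    have "L2norm (\<lambda>x. p (x + axis k h) - p x) \<le> ?K * L2norm (\<lambda>\<xi>. ?m \<xi> * ?g \<xi>)"
      unfolding p_def by (rule L2norm_shift_diff_le_mfrft[OF lam sin f])
    also have "\<dots> \<le> ?K * (?c * ?b)"
    proof (rule mult_left_mono)
      have "L2norm (\<lambda>\<xi>. ?m \<xi> * ?g \<xi>) \<le> L2norm (\<lambda>\<xi>. of_real ?c * (of_real (\<xi> $ k) * ?g \<xi>))"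
      proof (rule L2norm_mono)
        show "square_integrable (\<lambda>\<xi>. ?m \<xi> * ?g \<xi>)"
          by (rule square_integrable_multiplier(1)[OF square_integrable_mfrft[OF lam sin f]])
        show "square_integrable (\<lambda>\<xi>. of_real ?c * (of_real (\<xi> $ k) * ?g \<xi>))"
          by (rule square_integrable_cmult[OF xg])
        show "AE \<xi> in lebesgue. cmod (?m \<xi> * ?g \<xi>) \<le> cmod (of_real ?c * (of_real (\<xi> $ k) * ?g \<xi>))"
        proof (rule AE_I2)
          fix \<xi> :: "real ^ 'n"
          have "cmod (?m \<xi>) \<le> \<bar>axis k h \<bullet> mfrft_freq \<alpha> lam \<xi>\<bar>" by (rule cmod_cis_minus_one_le)
          also have "\<dots> = ?c * \<bar>\<xi> $ k\<bar>"
            using h by (simp add: inner_axis' mfrft_freq_def abs_mult)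
          finally have "cmod (?m \<xi>) * cmod (?g \<xi>) \<le> (?c * \<bar>\<xi> $ k\<bar>) * cmod (?g \<xi>)"
            by (rule mult_right_mono) simp
          then show "cmod (?m \<xi> * ?g \<xi>) \<le> cmod (of_real ?c * (of_real (\<xi> $ k) * ?g \<xi>))"
            using h by (simp add: norm_mult abs_mult mult.assoc norm_power norm_divide)
        qed
      qed
      also have "\<dots> = ?c * ?b"
        using h by (simp only: L2norm_cmult norm_of_real) (simp add: abs_mult)
      finally show "L2norm (\<lambda>\<xi>. ?m \<xi> * ?g \<xi>) \<le> ?c * ?b" .
    qed simp
    finally show "L2norm (\<lambda>x. p (x + axis k h) - p x) \<le> h * (?K * lam\<^sup>2 / \<bar>sin (\<alpha> $ k)\<bar> * ?b)"
      by (simp add: mult_ac)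
  qed
  then show ?thesis
    unfolding e L2norm_chirp by (simp add: p_def L2norm_chirp mult_ac)
qed

lemma nn_integral_norm_weight:
  fixes f :: "real ^ 'n \<Rightarrow> complex"
  assumes f: "f \<in> borel_measurable lebesgue"
    and fin: "(\<integral>\<^sup>+ t. ennreal ((norm t)\<^sup>2 * (cmod (f t))\<^sup>2) \<partial>lebesgue) < \<infinity>"
  shows "\<And>k. square_integrable (\<lambda>x. of_real (x $ k) * f x)"
    and "(\<integral>\<^sup>+ t. ennreal ((norm t)\<^sup>2 * (cmod (f t))\<^sup>2) \<partial>lebesgue)
       = ennreal (\<Sum>k\<in>UNIV. (L2norm (\<lambda>x. of_real (x $ k) * f x))\<^sup>2)"
proof -
  note [measurable] = f
  have [measurable]: "(\<lambda>x::real^'n. x $ k) \<in> borel_measurable lebesgue" for k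
    by (intro borel_measurable_continuous_lebesgue continuous_intros)
  have n2: "(norm x)\<^sup>2 = (\<Sum>k\<in>UNIV. (x $ k)\<^sup>2)" for x :: "real^'n"
    by (simp add: norm_vec_def L2_set_def sum_nonneg)
  have m: "(\<lambda>x. of_real (x $ k) * f x) \<in> borel_measurable lebesgue" for k by measurable
  have "(\<integral>\<^sup>+ t. ennreal ((norm t)\<^sup>2 * (cmod (f t))\<^sup>2) \<partial>lebesgue)
      = (\<integral>\<^sup>+ t. (\<Sum>k\<in>UNIV. ennreal ((cmod (of_real (t $ k) * f t))\<^sup>2)) \<partial>lebesgue)"
    by (intro nn_integral_cong) (simp add: n2 sum_distrib_right norm_mult power_mult_distrib sum_nonneg)
  also have "\<dots> = (\<Sum>k\<in>UNIV. \<integral>\<^sup>+ t. ennreal ((cmod (of_real (t $ k) * f t))\<^sup>2) \<partial>lebesgue)"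
    by (intro nn_integral_sum) measurable
  finally have eq: "(\<integral>\<^sup>+ t. ennreal ((norm t)\<^sup>2 * (cmod (f t))\<^sup>2) \<partial>lebesgue)
      = (\<Sum>k\<in>UNIV. \<integral>\<^sup>+ t. ennreal ((cmod (of_real (t $ k) * f t))\<^sup>2) \<partial>lebesgue)" .
  have fink: "(\<integral>\<^sup>+ t. ennreal ((cmod (of_real (t $ k) * f t))\<^sup>2) \<partial>lebesgue) < \<infinity>" for k
  proof -
    have "(\<integral>\<^sup>+ t. ennreal ((cmod (of_real (t $ k) * f t))\<^sup>2) \<partial>lebesgue)
       \<le> (\<Sum>k\<in>UNIV. \<integral>\<^sup>+ t. ennreal ((cmod (of_real (t $ k) * f t))\<^sup>2) \<partial>lebesgue)"
      by (intro member_le_sum) auto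
    then show ?thesis using fin unfolding eq by (rule order_le_less_trans)
  qed
  show sq: "square_integrable (\<lambda>x. of_real (x $ k) * f x)" for k
    using fink[of k] m[of k] unfolding square_integrable_def by (auto intro!: integrableI_bounded)
  show "(\<integral>\<^sup>+ t. ennreal ((norm t)\<^sup>2 * (cmod (f t))\<^sup>2) \<partial>lebesgue)
       = ennreal (\<Sum>k\<in>UNIV. (L2norm (\<lambda>x. of_real (x $ k) * f x))\<^sup>2)"
    unfolding eq nn_integral_square[OF sq] by simp
qed

lemma norm_weight_eq_0:
  fixes f :: "real ^ 'n \<Rightarrow> complex"
  assumes f: "square_integrable f"
    and 0: "(\<integral>\<^sup>+ t. ennreal ((norm t)\<^sup>2 * (cmod (f t))\<^sup>2) \<partial>lebesgue) = 0"
  shows "L2norm f = 0"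
proof -
  note [measurable] = f
  have [measurable]: "(norm :: real ^ 'n \<Rightarrow> real) \<in> borel_measurable lebesgue"
    by (rule borel_measurable_continuous_lebesgue) (intro continuous_intros)
  have "AE t in lebesgue. ennreal ((norm t)\<^sup>2 * (cmod (f t))\<^sup>2) = 0"
    using 0 by (subst (asm) nn_integral_0_iff_AE) auto
  moreover have "AE t in (lebesgue :: (real^'n) measure). t \<noteq> 0"
    by (intro AE_completion AE_lborel_singleton)
  ultimately have "AE t in lebesgue. (cmod (f t))\<^sup>2 = 0"
    by eventually_elim (simp add: ennreal_eq_0_iff zero_less_mult_iff mult_le_0_iff)
  then have "(LINT t|lebesgue. (cmod (f t))\<^sup>2) = 0"
    by (intro integral_eq_zero_AE)
  then show ?thesis by (simp add: L2norm_def)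
qed

lemma heisenberg_P_eq:
  fixes \<alpha> :: "real ^ 'n"
  assumes sin: "\<And>k. sin (\<alpha> $ k) \<noteq> 0"
  shows "heisenberg_P \<alpha> lam = 1 / (heisenberg_M2 \<alpha> * (lam\<^sup>2) ^ (CARD('n) + 2))"
  using abs_sin_prod_pos[of \<alpha>, OF sin] by (simp add: heisenberg_P_def cmod_mfrft_c_sq[OF sin])

lemma heisenberg_M2_ge: "1 / (sin (\<alpha> $ k))\<^sup>2 \<le> heisenberg_M2 \<alpha>"
  unfolding heisenberg_M2_def by (rule Max_ge) auto

text \<open>
  Summing the coordinate inequalities and applying the Cauchy-Schwarz inequality to the sum over the
  coordinates produces the factor \<open>N\<^sup>2\<close>; \<open>sqrt M\<close> is the largest of the factors \<open>1 / |sin (\<alpha> $ k)|\<close>.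
\<close>

lemma heisenberg_finite:
  fixes \<alpha> :: "real ^ 'n" and f :: "real ^ 'n \<Rightarrow> complex"
  assumes lam: "lam \<noteq> 0" and sin: "\<And>k. sin (\<alpha> $ k) \<noteq> 0" and f: "square_integrable f"
    and xf: "\<And>k. square_integrable (\<lambda>x. of_real (x $ k) * f x)"
    and xg: "\<And>k. square_integrable (\<lambda>\<xi>. of_real (\<xi> $ k) * mfrft \<alpha> lam f \<xi>)"
  shows "heisenberg_P \<alpha> lam * ((real CARD('n))\<^sup>2 / 4) * L2norm f ^ 4
     \<le> (\<Sum>k\<in>UNIV. (L2norm (\<lambda>x. of_real (x $ k) * f x))\<^sup>2)
       * (\<Sum>k\<in>UNIV. (L2norm (\<lambda>\<xi>. of_real (\<xi> $ k) * mfrft \<alpha> lam f \<xi>))\<^sup>2)"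
proof -
  define a where "a = (\<lambda>k. L2norm (\<lambda>x. of_real (x $ k) * f x))"
  define b where "b = (\<lambda>k. L2norm (\<lambda>\<xi>. of_real (\<xi> $ k) * mfrft \<alpha> lam f \<xi>))"
  define M where "M = heisenberg_M2 \<alpha>"
  define L where "L = \<bar>lam\<bar> ^ CARD('n) * lam\<^sup>2"
  have ab: "0 \<le> a k" "0 \<le> b k" for k by (simp_all add: a_def b_def L2norm_nonneg)
  have M: "0 < M"
    \<comment> \<open>Any index serves as a witness; the type of indices is nonempty.\<close>
    using heisenberg_M2_ge[of \<alpha> undefined] sin[of undefined] unfolding M_def
    by (metis less_le_trans zero_less_divide_1_iff zero_less_power2)
  have L: "0 < L" using lam by (simp add: L_def)
  have "(L2norm f)\<^sup>2 \<le> 2 * L * sqrt M * (a k * b k)" for k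
  proof -
    have "1 / \<bar>sin (\<alpha> $ k)\<bar> = sqrt (1 / (sin (\<alpha> $ k))\<^sup>2)" by (simp add: real_sqrt_divide)
    also have "\<dots> \<le> sqrt M" unfolding M_def by (rule real_sqrt_le_mono[OF heisenberg_M2_ge])
    finally have s: "1 / \<bar>sin (\<alpha> $ k)\<bar> \<le> sqrt M" .
    have "(L2norm f)\<^sup>2 \<le> (2 * L * (a k * b k)) * (1 / \<bar>sin (\<alpha> $ k)\<bar>)"
      using mfrft_coordinate_uncertainty[OF lam sin f xf[of k] xg[of k]]
      by (simp add: L_def a_def b_def mult_ac)
    also have "\<dots> \<le> (2 * L * (a k * b k)) * sqrt M"
      using L ab by (intro mult_left_mono s) auto
    finally show ?thesis by (simp add: mult_ac)
  qed
  then have "(\<Sum>k\<in>(UNIV::'n set). (L2norm f)\<^sup>2) \<le> (\<Sum>k\<in>UNIV. 2 * L * sqrt M * (a k * b k))"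
    by (intro sum_mono)
  then have "real CARD('n) * (L2norm f)\<^sup>2 \<le> 2 * L * sqrt M * (\<Sum>k\<in>UNIV. a k * b k)"
    by (simp add: sum_distrib_left)
  then have "(real CARD('n) * (L2norm f)\<^sup>2)\<^sup>2 \<le> (2 * L * sqrt M * (\<Sum>k\<in>UNIV. a k * b k))\<^sup>2"
    by (rule power_mono) simp
  also have "\<dots> = 4 * L\<^sup>2 * M * (\<Sum>k\<in>UNIV. a k * b k)\<^sup>2"
    using M by (simp add: power_mult_distrib)
  also have "\<dots> \<le> 4 * L\<^sup>2 * M * ((\<Sum>k\<in>UNIV. (a k)\<^sup>2) * (\<Sum>k\<in>UNIV. (b k)\<^sup>2))"
    using M by (intro mult_left_mono Cauchy_Schwarz_ineq_sum) auto
  finally have main: "(real CARD('n))\<^sup>2 * L2norm f ^ 4 \<le> 4 * L\<^sup>2 * M * ((\<Sum>k\<in>UNIV. (a k)\<^sup>2) * (\<Sum>k\<in>UNIV. (b k)\<^sup>2))"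
    by (simp add: power_mult_distrib flip: power_mult)
  have L2: "L\<^sup>2 = (lam\<^sup>2) ^ (CARD('n) + 2)"
  proof -
    have "(\<bar>lam\<bar> ^ CARD('n))\<^sup>2 = (\<bar>lam\<bar>\<^sup>2) ^ CARD('n)"
      by (simp only: power_mult[symmetric] mult.commute)
    then show ?thesis by (simp add: L_def power_mult_distrib power_add mult.commute)
  qed
  have "heisenberg_P \<alpha> lam * ((real CARD('n))\<^sup>2 / 4) * L2norm f ^ 4
      = ((real CARD('n))\<^sup>2 * L2norm f ^ 4) / (4 * L\<^sup>2 * M)"
    unfolding heisenberg_P_eq[OF sin] L2[symmetric] M_def by simp
  also have "\<dots> \<le> (\<Sum>k\<in>UNIV. (a k)\<^sup>2) * (\<Sum>k\<in>UNIV. (b k)\<^sup>2)"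
    using main L M by (subst pos_divide_le_eq) (simp_all add: mult_ac)
  finally show ?thesis by (simp add: a_def b_def)
qed

theorem mainTheorem9:
  fixes \<alpha> :: "real ^ 'n" and lam :: real and f :: "real ^ 'n \<Rightarrow> complex"
  assumes "lam \<noteq> 0"
    and "\<And>k. \<alpha> $ k \<in> {-pi<..<pi} - {0}"
    and "square_integrable f"
  shows "(\<integral>\<^sup>+ t. ennreal ((norm t)\<^sup>2 * (cmod (f t))\<^sup>2) \<partial>lebesgue)
       * (\<integral>\<^sup>+ \<xi>. ennreal ((norm \<xi>)\<^sup>2 * (cmod (mfrft \<alpha> lam f \<xi>))\<^sup>2) \<partial>lebesgue)
       \<ge> ennreal (heisenberg_P \<alpha> lam * ((real CARD('n))\<^sup>2 / 4) * L2norm f ^ 4)"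
proof -
  have sin: "sin (\<alpha> $ k) \<noteq> 0" for k
    using assms(2)[of k] sin_gt_zero[of "\<alpha> $ k"] sin_gt_zero[of "- (\<alpha> $ k)"]
    by (cases "\<alpha> $ k > 0") auto
  note lam = assms(1) and f = assms(3)
  note g = square_integrable_mfrft[OF lam sin f]
  let ?X = "\<integral>\<^sup>+ t. ennreal ((norm t)\<^sup>2 * (cmod (f t))\<^sup>2) \<partial>lebesgue"
  let ?Y = "\<integral>\<^sup>+ \<xi>. ennreal ((norm \<xi>)\<^sup>2 * (cmod (mfrft \<alpha> lam f \<xi>))\<^sup>2) \<partial>lebesgue"
  \<comment> \<open>In \<^typ>\<open>ennreal\<close> the product \<open>0 * \<infinity>\<close> is \<open>0\<close>, so a vanishing factor has to be excluded before an infinite one is used.\<close>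
  consider "?X = 0" | "?Y = 0" | "?X \<noteq> 0" "?Y \<noteq> 0" "?X = \<infinity> \<or> ?Y = \<infinity>" | "?X < \<infinity>" "?Y < \<infinity>"
    unfolding infinity_ennreal_def less_top[symmetric] by blast
  then show ?thesis
  proof cases
    case 1
    from norm_weight_eq_0[OF f this] show ?thesis by simp
  next
    case 2
    then have "L2norm (mfrft \<alpha> lam f) = 0" by (rule norm_weight_eq_0[OF g])
    then have "L2norm f = 0"
      using L2norm_le_mfrft[OF lam sin f] L2norm_nonneg[of f] by simp
    then show ?thesis by simp
  next
    case 3
    then have "?X * ?Y = \<infinity>" by (auto simp: ennreal_mult_eq_top_iff)
    then show ?thesis by simp
  next
    case 4
    note X = nn_integral_norm_weight[OF square_integrable_measurable[OF f] 4(1)]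
    note Y = nn_integral_norm_weight[OF square_integrable_measurable[OF g] 4(2)]
    show ?thesis
      unfolding X(2) Y(2) using heisenberg_finite[OF lam sin f X(1) Y(1)]
      by (subst ennreal_mult[symmetric]) (auto intro!: ennreal_leI sum_nonneg)
  qed
qed

end
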